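(* Let $A=(a_{ij})\in H_n$ with $a_{ii}\neq 0$ for all $i\in\{1,\dots,n\}$. Then $\rho(H_{FGS})<1$ (i.e., the sequence $\{x^{(i)}\}$ generated by the FGS scheme converges to the unique solution of $Ax=b$ for any choice of the initial guess $x^{(0)}$) if and only if both of the following hold: (i) $A$ has no $2\times 2$ irreducible principal submatrix belonging to $GDE_2$; (ii) $A$ has no irreducible principal submatrix $A_k=A(i_1,i_2,\dots,i_k)$, $3\le k\le n$, such that $D_{A_k}^{-1}A_k\in \mathscr{U}^{\psi}_k\cap GDE_k$ for some $\psi\in\mathbb{R}$, where $D_{A_k}=\mathrm{diag}(a_{i_1i_1},\dots,a_{i_ki_k})$.
   Context: The comparison matrix $\mu(A)=(\mu_{ij})$ of $A\in\mathbb{C}^{n\times n}$ has $\mu_{ii}=|a_{ii}|$ and $\mu_{ij}=-|a_{ij}|$ for $i\ne j$. A real matrix with nonpositive off-diagonal entries is an $M$-matrix if it equals $sI-B$ with $B\ge 0$ entrywise and $s\ge\rho(B)$ (singular $M$-matrices are allowed). $H_n$ (general $H$-matrices) is the set of $A\in\mathbb{C}^{n\times n}$ such that $\mu(A)$ is an $M$-matrix. $GDE_k$ is the set of generalized diagonally equipotent $k\times k$ complex matrices: there are positive constants $\alpha_1,\dots,\alpha_k$ with $\alpha_i|a_{ii}|=\sum_{j\ne i}\alpha_j|a_{ij}|$ for all $i$. $A(i_1,\dots,i_k)$, $i_1<\dots<i_k$, is the principal submatrix of $A$ with rows and columns $i_1,\dots,i_k$. Write $A=D_A-L_A-U_A$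 with $D_A=\mathrm{diag}(a_{11},\dots,a_{nn})$, $L_A$ strictly lower triangular, $U_A$ strictly upper triangular. The forward Gauss-Seidel (FGS) iteration matrix is $H_{FGS}=(D_A-L_A)^{-1}U_A$, and the FGS scheme for $Ax=b$ is $x^{(i+1)}=H_{FGS}x^{(i)}+(D_A-L_A)^{-1}b$, $i=0,1,2,\dots$. $\rho$ denotes the spectral radius. A matrix $(e^{i\psi_{rs}})\in\mathbb{C}^{k\times k}$ ($\psi_{rs}\in\mathbb{R}$, $i=\sqrt{-1}$) is a $\psi$-ray pattern matrix ($\psi\in\mathbb{R}$) if, modulo $2\pi$: (1) $\psi_{rs}+\psi_{sr}\equiv\psi$ for all $r\ne s$; (2) $\psi_{rs}-\psi_{rt}\equiv\psi_{ts}+\pi$ whenever $r<s<t$ or $s<t<r$ or $t<r<s$; (3) $\psi_{rs}-\psi_{rt}\equiv\psi_{ts}-\psi+\pi$ whenever $r<t<s$ or $t<s<r$ or $s<r<t$; (4) $\psi_{rr}=0$ for all $r$. $\mathscr{U}^{\psi}_k$ is the set of $k\times k$ complex matrices $B=(b_{rs})$ for which there exist $\eta\in\mathbb{R}$ and a $\psi$-ray pattern matrix $(e^{i\psi_{rs}})$ with $b_{rs}=e^{i\eta}|b_{rs}|e^{i\psi_{rs}}$ for all $r,s$. *)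

theory Defs
  imports
    "Jordan_Normal_Form.Spectral_Radius"
    "Jordan_Normal_Form.Gauss_Jordan_Elimination"
    "Jordan_Normal_Form.DL_Submatrix"
    "HOL-Library.Real_Mod"
    "HOL-Combinatorics.Permutations"
begin

text \<open>
  All matrices are those of Jordan_Normal_Form, with rows and columns indexed from 0.
\<close>

definition comparison_mat :: "complex mat \<Rightarrow> real mat" where
  "comparison_mat A = mat (dim_row A) (dim_col A)
     (\<lambda>(i, j). if i = j then cmod (A $$ (i, i)) else - cmod (A $$ (i, j)))"

definition M_matrix :: "nat \<Rightarrow> real mat \<Rightarrow> bool" where
  "M_matrix n M \<longleftrightarrow> M \<in> carrier_mat n n \<and>
     (\<forall>i<n. \<forall>j<n. i \<noteq> j \<longrightarrow> M $$ (i, j) \<le> 0) \<and>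
     (\<exists>s B. B \<in> carrier_mat n n \<and> (\<forall>i<n. \<forall>j<n. 0 \<le> B $$ (i, j)) \<and>
        s \<ge> spectral_radius (map_mat complex_of_real B) \<and>
        M = s \<cdot>\<^sub>m 1\<^sub>m n - B)"

definition general_H_matrices :: "nat \<Rightarrow> complex mat set" where
  "general_H_matrices n = {A \<in> carrier_mat n n. M_matrix n (comparison_mat A)}"

definition GDE :: "nat \<Rightarrow> complex mat set" where
  "GDE k = {A \<in> carrier_mat k k. \<exists>\<alpha> :: nat \<Rightarrow> real. (\<forall>i<k. 0 < \<alpha> i) \<and>
     (\<forall>i<k. \<alpha> i * cmod (A $$ (i, i)) = (\<Sum>j\<in>{..<k} - {i}. \<alpha> j * cmod (A $$ (i, j))))}"

text \<open>
  Reducibility: for some permutation matrix \<open>P\<close>, the matrix \<open>P A P\<^sup>T\<close>, whose \<open>(i, j)\<close> entry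
  is \<open>A $$ (p i, p j)\<close>, is block upper triangular with square diagonal blocks of orders
  \<open>r\<close> and \<open>k - r\<close>, \<open>0 < r < k\<close>. (Every matrix of order 1 counts as irreducible here;
  some authors exclude the zero matrix of order 1.)
\<close>

definition reducible_mat :: "nat \<Rightarrow> complex mat \<Rightarrow> bool" where
  "reducible_mat k A \<longleftrightarrow> (\<exists>p r. p permutes {..<k} \<and> 0 < r \<and> r < k \<and>
     (\<forall>i j. r \<le> i \<and> i < k \<and> j < r \<longrightarrow> A $$ (p i, p j) = 0))"

definition irreducible_mat :: "nat \<Rightarrow> complex mat \<Rightarrow> bool" where
  "irreducible_mat k A \<longleftrightarrow> A \<in> carrier_mat k k \<and> \<not> reducible_mat k A"

text \<open>For \<open>I = {i\<^sub>1 < \<dots> < i\<^sub>k}\<close> this is \<open>A(i\<^sub>1, \<dots>, i\<^sub>k)\<close>.\<close>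

definition principal_submatrix :: "complex mat \<Rightarrow> nat set \<Rightarrow> complex mat" where
  "principal_submatrix A I = submatrix A I I"

text \<open>The inverse of an invertible matrix (unspecified for singular matrices).\<close>

definition inv_mat :: "complex mat \<Rightarrow> complex mat" where
  "inv_mat A = the (mat_inverse A)"

definition diag_part :: "complex mat \<Rightarrow> complex mat" where
  "diag_part A = mat_diag (dim_row A) (\<lambda>i. A $$ (i, i))"

text \<open>The signs are those of the splitting \<open>A = D - L - U\<close>.\<close>

definition lower_part :: "complex mat \<Rightarrow> complex mat" where
  "lower_part A = mat (dim_row A) (dim_col A) (\<lambda>(i, j). if j < i then - A $$ (i, j) else 0)"

definition upper_part :: "complex mat \<Rightarrow> complex mat" where
  "upper_part A = mat (dim_row A) (dim_col A) (\<lambda>(i, j). if i < j then - A $$ (i, j) else 0)"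

definition fgs_matrix :: "complex mat \<Rightarrow> complex mat" where
  "fgs_matrix A = inv_mat (diag_part A - lower_part A) * upper_part A"

fun fgs_seq :: "complex mat \<Rightarrow> complex vec \<Rightarrow> complex vec \<Rightarrow> nat \<Rightarrow> complex vec" where
  "fgs_seq A b x0 0 = x0"
| "fgs_seq A b x0 (Suc m) =
     fgs_matrix A *\<^sub>v fgs_seq A b x0 m + inv_mat (diag_part A - lower_part A) *\<^sub>v b"

text \<open>
  The system \<open>A x = b\<close> has a unique solution, and from every initial guess the scheme converges
  to it. Convergence is entrywise, since \<open>vec\<close> carries no topology.
\<close>

definition fgs_converges :: "nat \<Rightarrow> complex mat \<Rightarrow> complex vec \<Rightarrow> bool" where
  "fgs_converges n A b \<longleftrightarrow>
     (\<exists>x\<in>carrier_vec n. A *\<^sub>v x = b \<and> (\<forall>y\<in>carrier_vec n. A *\<^sub>v y = b \<longrightarrow> y = x) \<and>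
        (\<forall>x0\<in>carrier_vec n. \<forall>i<n. (\<lambda>m. fgs_seq A b x0 m $ i) \<longlonglongrightarrow> x $ i))"

definition psi_ray_pattern :: "nat \<Rightarrow> real \<Rightarrow> complex mat \<Rightarrow> bool" where
  "psi_ray_pattern k \<psi> R \<longleftrightarrow> R \<in> carrier_mat k k \<and>
     (\<exists>a :: nat \<Rightarrow> nat \<Rightarrow> real.
        (\<forall>r<k. \<forall>s<k. R $$ (r, s) = cis (a r s)) \<and>
        (\<forall>r<k. \<forall>s<k. r \<noteq> s \<longrightarrow> [a r s + a s r = \<psi>] (rmod 2 * pi)) \<and>
        (\<forall>r<k. \<forall>s<k. \<forall>t<k. (r < s \<and> s < t) \<or> (s < t \<and> t < r) \<or> (t < r \<and> r < s) \<longrightarrow>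
           [a r s - a r t = a t s + pi] (rmod 2 * pi)) \<and>
        (\<forall>r<k. \<forall>s<k. \<forall>t<k. (r < t \<and> t < s) \<or> (t < s \<and> s < r) \<or> (s < r \<and> r < t) \<longrightarrow>
           [a r s - a r t = a t s - \<psi> + pi] (rmod 2 * pi)) \<and>
        (\<forall>r<k. [a r r = 0] (rmod 2 * pi)))"

definition ray_class :: "nat \<Rightarrow> real \<Rightarrow> complex mat set" where
  "ray_class k \<psi> = {B \<in> carrier_mat k k. \<exists>\<eta> R. psi_ray_pattern k \<psi> R \<and>
     (\<forall>r<k. \<forall>s<k. B $$ (r, s) = cis \<eta> * complex_of_real (cmod (B $$ (r, s))) * R $$ (r, s))}"

end

(*
  An eigenvector x of the iteration matrix for an eigenvalue z with |z| >= 1 lies in the kernel of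
  the pencil z (D - L) - U.  Restricted to a minimal set C of indices of its support that has no
  edges to the rest of the support, the triangle inequality gives |a_ii| |x_i| <= sum |a_ij| |x_j|
  over C.  As the comparison matrix is an M-matrix, no nonnegative vector satisfies such
  inequalities with a strict one that can be reached from its whole support, so equality holds on
  the irreducible set C.  This forces |z| = 1, the equipotence of the submatrix with the weights
  |x_i|, and the alignment of all terms, which is the ray pattern with psi = arg z.

  Conversely, the weights and phases of a critical irreducible set I form a kernel vector of the
  pencil restricted to I.  By the same M-matrix argument I has no edge to an index outside I from
  which I can be reached, so the restricted kernel vector extends to the whole pencil.
*)

theory Submission
  imports Defs
begin

section \<open>M-matrices and subequilibria\<close>

text \<open>\<open>A\<close> may be reducible and its comparison matrix s I - B singular, so neither
  a positive Perron vector nor strict diagonal dominance is at hand. The M-matrix hypothesis enters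
  through growth instead: if y is nonnegative and nonzero and B y >= t y with t above the spectral
  radius of B, then B^m y >= t^m y is too large. Strict rows supply the gap between s and t. The
  pencil replaces the inverse in the iteration matrix by explicit entries: those on and below the
  diagonal carry the factor z, those above do not. For |z| >= 1 their moduli are at most |z| |a_ij|,
  and only entries above the diagonal can fall short. The jump by \<psi> across the diagonal in the
  ray pattern is the phase of this factor. In the converse, the indices outside I that reach I may
  themselves carry a singular block of the pencil; then a kernel vector of that block takes the
  place of the extension. For two indices every phase pattern is a ray pattern, and a single index
  cannot be equipotent with a nonzero diagonal entry; hence the separate sizes 2 and at least
  3.\<close>

lemma pow_mat_smult:
  fixes A :: "'a :: comm_semiring_1 mat"
  assumes "A \<in> carrier_mat n n"
  shows "(c \<cdot>\<^sub>m A) ^\<^sub>m m = c ^ m \<cdot>\<^sub>m (A ^\<^sub>m m)"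
proof (induction m)
  case 0
  then show ?case using assms by (intro eq_matI) auto
next
  case (Suc m)
  have Am: "A ^\<^sub>m m \<in> carrier_mat n n"
    using assms by (rule pow_carrier_mat)
  have cAm: "c ^ m \<cdot>\<^sub>m (A ^\<^sub>m m) \<in> carrier_mat n n"
    using Am by simp
  show ?case
    using Am assms
    by (simp add: Suc mult_smult_distrib[OF cAm assms] mult_smult_assoc_mat[OF Am assms])
      (intro eq_matI, auto simp: mult_ac)
qed

text \<open>Dividing by r brings the spectral radius below 1, where the Jordan normal form bounds
  all powers by one constant. The bound serves both the M-matrix argument and the convergence of the
  scheme.\<close>

lemma power_entries_bound:
  assumes A: "A \<in> carrier_mat n n" and r: "spectral_radius A < r" "0 < r"
  shows "\<exists>c. \<forall>m. \<forall>i<n. \<forall>j<n. cmod ((A ^\<^sub>m m) $$ (i, j)) \<le> c * r ^ m"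
proof (cases "n = 0")
  case False
  then have n: "n > 0" by simp
  define C where "C = complex_of_real (1 / r) \<cdot>\<^sub>m A"
  have C: "C \<in> carrier_mat n n" using A by (simp add: C_def)
  have AC: "A = complex_of_real r \<cdot>\<^sub>m C"
    using A r by (intro eq_matI) (auto simp: C_def)
  obtain k where k: "k \<in> spectrum C" "spectral_radius C = cmod k"
    using spectral_radius_mem_max(1)[OF C n] by auto
  from k(1) obtain v where v: "v \<in> carrier_vec n" "v \<noteq> 0\<^sub>v n" "C *\<^sub>v v = k \<cdot>\<^sub>v v"
    using C by (auto simp: spectrum_def eigenvalue_def eigenvector_def)
  have "A *\<^sub>v v = (of_real r * k) \<cdot>\<^sub>v v"
    using C v(1) unfolding smult_smult_assoc[symmetric] v(3)[symmetric] AC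
    by (intro eq_vecI) auto
  then have "of_real r * k \<in> spectrum A"
    using v A by (auto simp: spectrum_def eigenvalue_def eigenvector_def)
  then have "cmod (of_real r * k) \<le> spectral_radius A"
    using spectral_radius_mem_max(2)[OF A n] by blast
  moreover have "cmod (of_real r * k) = r * cmod k"
    using r by (simp add: norm_mult)
  ultimately have "r * cmod k < r * 1"
    using r(1) by linarith
  then have "spectral_radius C < 1"
    unfolding k(2) using mult_less_cancel_left_pos[OF r(2)] by blast
  then obtain c where c: "\<And>m. norm_bound (C ^\<^sub>m m) c"
    using spectral_radius_jnf_norm_bound_less_1_upper_triangular[OF C] by blast
  have "cmod ((A ^\<^sub>m m) $$ (i, j)) \<le> c * r ^ m" if "i < n" "j < n" for m i j
  proof -
    have Cm: "C ^\<^sub>m m \<in> carrier_mat n n"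
      using C by (rule pow_carrier_mat)
    have "(A ^\<^sub>m m) $$ (i, j) = of_real r ^ m * (C ^\<^sub>m m) $$ (i, j)"
      unfolding AC pow_mat_smult[OF C] using that carrier_matD[OF Cm] by simp
    moreover have "cmod ((C ^\<^sub>m m) $$ (i, j)) \<le> c"
      using c[of m] that carrier_matD[OF Cm] by (auto simp: norm_bound_def)
    ultimately show ?thesis
      using r(2) by (simp add: norm_mult norm_power mult_mono mult.commute)
  qed
  then show ?thesis by blast
qed auto

text \<open>Iterating the inequality gives B^m y >= t^m y, while the entries of B^m are O(r^m) for
  some r < t. This comparison of growth rates takes the place of a Perron vector.\<close>

lemma no_supersolution_above_spectral_radius:
  fixes B :: "real mat"
  assumes B: "B \<in> carrier_mat n n" and nn: "\<And>i j. i < n \<Longrightarrow> j < n \<Longrightarrow> 0 \<le> B $$ (i, j)"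
    and t: "spectral_radius (map_mat complex_of_real B) < t" "0 < t"
    and y: "\<And>i. i < n \<Longrightarrow> 0 \<le> y i"
    and ge: "\<And>i. i < n \<Longrightarrow> t * y i \<le> (\<Sum>j<n. B $$ (i, j) * y j)"
    and i: "i < n"
  shows "y i = 0"
proof (rule ccontr)
  assume "y i \<noteq> 0"
  then have yi: "y i > 0" using y[OF i] by simp
  \<comment> \<open>A rate strictly between the spectral radius and t; \<open>max 0\<close> makes it
    positive.\<close>
  define r where "r = (max 0 (spectral_radius (map_mat complex_of_real B)) + t) / 2"
  have r: "spectral_radius (map_mat complex_of_real B) < r" "0 < r" "r < t"
    using t by (auto simp: r_def)
  obtain c where c: "\<And>m i j. i < n \<Longrightarrow> j < n \<Longrightarrow>
      cmod ((map_mat complex_of_real B ^\<^sub>m m) $$ (i, j)) \<le> c * r ^ m"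
    using power_entries_bound[OF _ r(1,2)] B by (metis map_carrier_mat)
  have Bm: "B ^\<^sub>m m \<in> carrier_mat n n" for m
    using B by (rule pow_carrier_mat)
  have c': "\<bar>(B ^\<^sub>m m) $$ (i, j)\<bar> \<le> c * r ^ m" if "i < n" "j < n" for m i j
    using c[OF that, of m] that carrier_matD[OF Bm[of m]]
    by (simp add: of_real_hom.mat_hom_pow[OF B, symmetric])
  have Suc_pow: "(B ^\<^sub>m Suc m) $$ (i, j) = (\<Sum>k<n. (B ^\<^sub>m m) $$ (i, k) * B $$ (k, j))"
    if "i < n" "j < n" for m i j
    using that Bm[of m] B by (simp add: scalar_prod_def atLeast0LessThan)
  have nnm: "0 \<le> (B ^\<^sub>m m) $$ (i, j)" if "i < n" "j < n" for m i j
    using that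
  proof (induction m arbitrary: i j)
    case 0
    then show ?case using B by simp
  next
    case (Suc m)
    then show ?case unfolding Suc_pow[OF Suc.prems] by (intro sum_nonneg) (auto simp: nn)
  qed
  have low: "t ^ m * y i \<le> (\<Sum>j<n. (B ^\<^sub>m m) $$ (i, j) * y j)" if "i < n" for m i
  proof (induction m)
    case 0
    have "(\<Sum>j<n. (B ^\<^sub>m 0) $$ (i, j) * y j) = (\<Sum>j<n. if j = i then y j else 0)"
      using B that by (intro sum.cong) auto
    then show ?case using that by simp
  next
    case (Suc m)
    have "t ^ Suc m * y i \<le> t * (\<Sum>k<n. (B ^\<^sub>m m) $$ (i, k) * y k)"
      using Suc t(2) by simp
    also have "\<dots> = (\<Sum>k<n. (B ^\<^sub>m m) $$ (i, k) * (t * y k))"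
      by (simp add: sum_distrib_left mult.left_commute)
    also have "\<dots> \<le> (\<Sum>k<n. (B ^\<^sub>m m) $$ (i, k) * (\<Sum>j<n. B $$ (k, j) * y j))"
      using nnm[OF that] ge by (intro sum_mono mult_left_mono) auto
    also have "\<dots> = (\<Sum>k<n. \<Sum>j<n. (B ^\<^sub>m m) $$ (i, k) * B $$ (k, j) * y j)"
      by (simp add: sum_distrib_left mult.assoc)
    also have "\<dots> = (\<Sum>j<n. (\<Sum>k<n. (B ^\<^sub>m m) $$ (i, k) * B $$ (k, j)) * y j)"
      by (subst sum.swap) (simp add: sum_distrib_right)
    also have "\<dots> = (\<Sum>j<n. (B ^\<^sub>m Suc m) $$ (i, j) * y j)"
      using that by (intro sum.cong) (auto simp: Suc_pow simp del: pow_mat.simps)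
    finally show ?case .
  qed
  define K where "K = c * (\<Sum>j<n. y j)"
  have "t ^ m * y i \<le> r ^ m * K" for m
  proof -
    have "(\<Sum>j<n. (B ^\<^sub>m m) $$ (i, j) * y j) \<le> (\<Sum>j<n. (c * r ^ m) * y j)"
      using abs_le_D1[OF c'[OF i]] y by (intro sum_mono mult_right_mono) auto
    with low[OF i, of m] have "t ^ m * y i \<le> (\<Sum>j<n. (c * r ^ m) * y j)"
      by (rule order_trans)
    then show ?thesis by (simp add: K_def sum_distrib_left mult_ac)
  qed
  then have bd: "(t / r) ^ m \<le> K / y i" for m
    using r yi by (simp add: power_divide field_simps)
  have "1 < t / r" using r by simp
  then obtain m where "K / y i < (t / r) ^ m"
    using real_arch_pow by blast
  with bd[of m] show False by simp
qed

text \<open>With the comparison matrix written as s I - B, strictness on the support reads (B y)_i >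
  s y_i. The support is finite, so s can be raised to s + e, which lies above the spectral radius of
  B even when s equals it. Rows off the support hold because y vanishes there.\<close>

lemma general_H_matrix_no_strict_subequilibrium:
  assumes A: "A \<in> general_H_matrices n"
    and y: "\<And>i. i < n \<Longrightarrow> 0 \<le> y i"
    and gt: "\<And>i. i < n \<Longrightarrow> y i \<noteq> 0 \<Longrightarrow>
      cmod (A $$ (i, i)) * y i < (\<Sum>j\<in>{..<n} - {i}. cmod (A $$ (i, j)) * y j)"
    and i: "i < n"
  shows "y i = 0"
proof -
  have Ac: "A \<in> carrier_mat n n" and M: "M_matrix n (comparison_mat A)"
    using A by (auto simp: general_H_matrices_def)
  then obtain s B where B: "B \<in> carrier_mat n n" "\<And>i j. i < n \<Longrightarrow> j < n \<Longrightarrow> 0 \<le> B $$ (i, j)"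
    and s: "spectral_radius (map_mat complex_of_real B) \<le> s"
    and eq: "comparison_mat A = s \<cdot>\<^sub>m 1\<^sub>m n - B"
    unfolding M_matrix_def by auto
  have ent: "(if i = j then cmod (A $$ (i, i)) else - cmod (A $$ (i, j))) =
      (if i = j then s else 0) - B $$ (i, j)" if "i < n" "j < n" for i j
    using arg_cong[OF eq, of "\<lambda>M. M $$ (i, j)"] that Ac B(1)
    by (simp add: comparison_mat_def split: if_splits)
  have Boff: "B $$ (i, j) = cmod (A $$ (i, j))" if "i < n" "j < n" "i \<noteq> j" for i j
    using ent[OF that(1,2)] that by simp
  have Bdiag: "B $$ (i, i) = s - cmod (A $$ (i, i))" if "i < n" for i
    using ent[OF that that] by simp
  have row: "(\<Sum>j<n. B $$ (i, j) * y j) - s * y i =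
      (\<Sum>j\<in>{..<n} - {i}. cmod (A $$ (i, j)) * y j) - cmod (A $$ (i, i)) * y i" if "i < n" for i
    using that by (simp add: sum.remove[of "{..<n}" i] Bdiag Boff algebra_simps)
  have s0: "0 \<le> s"
  proof -
    have "map_mat complex_of_real B \<in> carrier_mat n n" "n > 0" using B i by auto
    from spectral_radius_mem_max(1)[OF this] have "0 \<le> spectral_radius (map_mat complex_of_real B)"
      by auto
    with s show ?thesis by simp
  qed
  define g where "g i = (\<Sum>j<n. B $$ (i, j) * y j) - s * y i" for i
  have gpos: "0 < g i" if "i < n" "y i \<noteq> 0" for i
    using gt[OF that] row[OF that(1)] by (simp add: g_def)
  \<comment> \<open>One e has to fit the slack \<open>g i\<close> of all rows in the support at
    once; finitely many conditions that hold near 0 hold together.\<close>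
  have "\<forall>\<^sub>F e in at_right 0. \<forall>i\<in>{i\<in>{..<n}. y i \<noteq> 0}. e * y i < g i"
  proof (intro eventually_ball_finite ballI, simp)
    fix i assume "i \<in> {i \<in> {..<n}. y i \<noteq> 0}"
    then have "i < n" "y i \<noteq> 0" by auto
    have "((\<lambda>e. e * y i) \<longlongrightarrow> 0 * y i) (at_right 0)"
      by (intro tendsto_intros)
    then show "\<forall>\<^sub>F e in at_right 0. e * y i < g i"
      using gpos[OF \<open>i < n\<close> \<open>y i \<noteq> 0\<close>] by (auto intro: order_tendstoD)
  qed
  then have "\<forall>\<^sub>F e in at_right 0. 0 < e \<and> (\<forall>i\<in>{i\<in>{..<n}. y i \<noteq> 0}. e * y i < g i)"
    using eventually_at_right_less[of "0::real"] by (simp add: eventually_conj_iff)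
  then obtain e where e: "e > 0" "\<And>i. i < n \<Longrightarrow> y i \<noteq> 0 \<Longrightarrow> e * y i < g i"
    using eventually_happens' trivial_limit_at_right_real by force
  show ?thesis
  proof (rule no_supersolution_above_spectral_radius[OF B(1,2) _ _ y _ i])
    show "spectral_radius (map_mat complex_of_real B) < s + e" "0 < s + e"
      using s s0 e by auto
    fix i assume i: "i < n"
    show "(s + e) * y i \<le> (\<Sum>j<n. B $$ (i, j) * y j)"
    proof (cases "y i = 0")
      case True
      then show ?thesis using i B y by (auto intro!: sum_nonneg)
    next
      case False
      then show ?thesis using e(2)[OF i False] by (simp add: g_def algebra_simps)
    qed
  qed
qed

text \<open>Raising \<open>y\<close> slightly at an index \<open>k\<close> whose row inequality is strict makes the rows of all
  predecessors of \<open>k\<close> strict. Repeating this would contradict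
  \<open>general_H_matrix_no_strict_subequilibrium\<close>. The hypothesis \<open>reach\<close> says that every index of
  the support of \<open>y\<close> reaches a strict row.\<close>

lemma strict_row_unreachable:
  fixes A :: "complex mat" and n :: nat
  defines "S \<equiv> \<lambda>y :: nat \<Rightarrow> real. \<lambda>i. \<Sum>j\<in>{..<n} - {i}. cmod (A $$ (i, j)) * y j"
  assumes A: "A \<in> general_H_matrices n"
    and d: "\<And>i. i < n \<Longrightarrow> A $$ (i, i) \<noteq> 0"
    and y: "\<And>i. i < n \<Longrightarrow> 0 \<le> y i"
    and ge: "\<And>i. i < n \<Longrightarrow> cmod (A $$ (i, i)) * y i \<le> S y i"
    and reach: "\<And>X i. \<lbrakk>X \<subseteq> {..<n}; \<And>l. l < n \<Longrightarrow> cmod (A $$ (l, l)) * y l < S y l \<Longrightarrow> l \<in> X;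
      \<And>l j. l < n \<Longrightarrow> j \<in> X \<Longrightarrow> l \<noteq> j \<Longrightarrow> A $$ (l, j) \<noteq> 0 \<Longrightarrow> l \<in> X; i < n; y i \<noteq> 0\<rbrakk> \<Longrightarrow> i \<in> X"
    and i: "i < n"
  shows "y i = 0"
  using y ge reach i
\<comment> \<open>The induction is on the number of rows that are not strict, for all y together,
  since each step replaces y by a modified vector.\<close>
proof (induction "n - card {l. l < n \<and> cmod (A $$ (l, l)) * y l < S y l}" arbitrary: y i rule: less_induct)
  case (less y)
  note ge = less.prems(2)
  define T where "T = {l. l < n \<and> cmod (A $$ (l, l)) * y l < S y l}"
  show ?case
  proof (cases "\<forall>l<n. y l \<noteq> 0 \<longrightarrow> l \<in> T")
    case True
    show ?thesis
      by (rule general_H_matrix_no_strict_subequilibrium[OF A _ _ less.prems(4), of y])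
        (use True in \<open>auto simp: T_def S_def less.prems(1)\<close>)
  next
    case False
    then obtain m where m: "m < n" "y m \<noteq> 0" "m \<notin> T" by blast
    \<comment> \<open>If no edge entered T from outside, T would itself be a set X as in the
      reachability hypothesis, and m would lie in it.\<close>
    have "\<exists>l<n. \<exists>k\<in>T. l \<notin> T \<and> A $$ (l, k) \<noteq> 0"
    proof (rule ccontr)
      assume *: "\<not> ?thesis"
      have "m \<in> T"
        by (rule less.prems(3)[of T, OF _ _ _ m(1,2)]) (use * in \<open>auto simp: T_def\<close>)
      with m show False by simp
    qed
    then obtain l k where lk: "l < n" "k \<in> T" "l \<notin> T" "A $$ (l, k) \<noteq> 0" by blast
    then have k: "k < n" "l \<noteq> k" by (auto simp: T_def)
    \<comment> \<open>Raising y at k by e increases the left side of row k by half of its slack and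
      leaves its right side alone, so row k stays strict.\<close>
    define e where "e = (S y k - cmod (A $$ (k, k)) * y k) / (2 * cmod (A $$ (k, k)))"
    have "e > 0" using lk(2) d[OF k(1)] by (simp add: e_def T_def)
    define z where "z = y(k := y k + e)"
    have Sz: "S z j = S y j + (if j = k then 0 else cmod (A $$ (j, k)) * e)" for j
    proof (cases "j = k")
      case True
      then show ?thesis by (auto simp: S_def z_def intro!: sum.cong)
    next
      case False
      then have "S z j = (\<Sum>i\<in>{..<n} - {j}. cmod (A $$ (j, i)) * y i + (if i = k then cmod (A $$ (j, k)) * e else 0))"
        unfolding S_def by (intro sum.cong) (auto simp: z_def distrib_left)
      then show ?thesis using False k by (simp add: S_def sum.distrib)
    qed
    have zk: "cmod (A $$ (k, k)) * z k < S z k"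
      using lk(2) d[OF k(1)] by (simp add: Sz) (simp add: z_def e_def T_def field_simps)
    have zj: "S y j \<le> S z j" "z j = y j" if "j \<noteq> k" for j
      using that \<open>e > 0\<close> by (simp_all add: Sz) (simp add: z_def)
    have zl: "cmod (A $$ (l, l)) * z l < S z l"
    proof -
      have "0 < cmod (A $$ (l, k)) * e" using lk(4) \<open>e > 0\<close> by simp
      then show ?thesis using ge[OF lk(1)] k by (simp add: Sz zj(2))
    qed
    define T' where "T' = {l. l < n \<and> cmod (A $$ (l, l)) * z l < S z l}"
    have sub: "insert l T \<subseteq> T'"
    proof -
      have "j \<in> T'" if "j \<in> T" for j
        using that zk zj[of j] by (cases "j = k") (auto simp: T_def T'_def)
      then show ?thesis using zl lk(1) by (auto simp: T'_def)
    qed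
    have fin: "finite T'" "finite T" by (auto simp: T'_def T_def)
    then have "card T < card T'"
      using card_mono[OF fin(1) sub] lk(3) by simp
    moreover have "card T' \<le> n"
      using card_mono[of "{..<n}" T'] by (auto simp: T'_def)
    ultimately have dec: "n - card T' < n - card T" by simp
    \<comment> \<open>The induction hypothesis makes z vanish at k, although z k = y k + e is
      positive: this is the contradiction.\<close>
    have "z k = 0"
    proof (rule less.hyps[OF dec[unfolded T_def T'_def] _ _ _ k(1)])
      show "0 \<le> z i" if "i < n" for i
        using less.prems(1)[OF that] \<open>e > 0\<close> by (cases "i = k") (simp_all add: z_def)
      show "cmod (A $$ (i, i)) * z i \<le> S z i" if "i < n" for i
        using ge[OF that] zk zj[of i] by (cases "i = k") auto
      fix X i
      assume X: "X \<subseteq> {..<n}" "\<And>l. l < n \<Longrightarrow> cmod (A $$ (l, l)) * z l < S z l \<Longrightarrow> l \<in> X"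
        "\<And>l j. l < n \<Longrightarrow> j \<in> X \<Longrightarrow> l \<noteq> j \<Longrightarrow> A $$ (l, j) \<noteq> 0 \<Longrightarrow> l \<in> X" "i < n" "z i \<noteq> 0"
      \<comment> \<open>Strict rows of y remain strict for z, so a set X admissible for z is
        admissible for y. The only index that can be new in the support is k, and it lies in
        T.\<close>
      have TX: "T \<subseteq> X" using sub X(2) by (auto simp: T'_def)
      show "i \<in> X"
      proof (cases "i = k")
        case True
        then show ?thesis using TX lk by auto
      next
        case False
        show ?thesis
          by (rule less.prems(3)[OF X(1) _ _ X(4)]) (use TX X(3,5) zj(2)[OF False] in \<open>auto simp: T_def\<close>)
      qed
    qed
    then show ?thesis
      using less.prems(1)[OF k(1)] \<open>e > 0\<close> by (simp add: z_def)
  qed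
qed

section \<open>Irreducible principal submatrices\<close>

text \<open>Strong connectivity of the digraph of \<open>A\<close> on \<open>I\<close>, phrased by
  cuts: the later minimality and closure arguments produce the sets S directly, without paths or
  permutations. Sets with at most one element qualify vacuously.\<close>

definition irreducible_on :: "'a :: zero mat \<Rightarrow> nat set \<Rightarrow> bool" where
  "irreducible_on A I \<longleftrightarrow> (\<forall>S\<subseteq>I. S \<noteq> {} \<longrightarrow> S \<noteq> I \<longrightarrow> (\<exists>i\<in>I - S. \<exists>j\<in>S. A $$ (i, j) \<noteq> 0))"

lemma bij_betw_pick:
  assumes "finite I"
  shows "bij_betw (pick I) {..<card I} I"
proof -
  have inj: "inj_on (pick I) {..<card I}"
  proof (rule linorder_inj_onI)
    fix i j assume "i < j" "j \<in> {..<card I}"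
    then show "pick I i \<noteq> pick I j" using pick_mono_le[of j I i] by simp
  qed auto
  moreover have "pick I ` {..<card I} = I"
    by (rule card_subset_eq[OF assms]) (auto simp: pick_in_set_le card_image inj)
  ultimately show ?thesis by (simp add: bij_betw_def)
qed

text \<open>Order must survive the passage to a principal submatrix, because the ray pattern
  distinguishes entries above the diagonal from those below it.\<close>

lemma pick_less_iff:
  assumes "i < card I" "j < card I"
  shows "pick I i < pick I j \<longleftrightarrow> i < j"
  using pick_mono_le[OF assms(1), of j] pick_mono_le[OF assms(2), of i]
  by (cases i j rule: linorder_cases) auto

lemma principal_submatrix_index:
  assumes "A \<in> carrier_mat n n" "I \<subseteq> {..<n}" "i < card I" "j < card I"
  shows "principal_submatrix A I $$ (i, j) = A $$ (pick I i, pick I j)"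
proof -
  have "{i. i < n \<and> i \<in> I} = I" using assms(2) by auto
  then show ?thesis using assms by (simp add: principal_submatrix_def submatrix_index)
qed

lemma principal_submatrix_carrier:
  assumes "A \<in> carrier_mat n n" "I \<subseteq> {..<n}"
  shows "principal_submatrix A I \<in> carrier_mat (card I) (card I)"
proof -
  have "{i. i < n \<and> i \<in> I} = I" using assms(2) by auto
  then show ?thesis
    using assms by (intro carrier_matI) (auto simp: principal_submatrix_def dim_submatrix)
qed

text \<open>The image of the first r indices under the permutation is a cut. Conversely, a cut S
  yields a permutation by enumerating S first and its complement afterwards.\<close>

lemma reducible_mat_iff_cut:
  "reducible_mat k M \<longleftrightarrow> \<not> irreducible_on M {..<k}"
proof
  assume "reducible_mat k M"
  then obtain p r where p: "p permutes {..<k}" and r: "0 < r" "r < k"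
    and z: "\<And>i j. r \<le> i \<Longrightarrow> i < k \<Longrightarrow> j < r \<Longrightarrow> M $$ (p i, p j) = 0"
    unfolding reducible_mat_def by blast
  let ?S = "p ` {..<r}"
  have inj: "inj p" using p permutes_inj by blast
  have "?S \<subseteq> {..<k}"
    using image_mono[of "{..<r}" "{..<k}" p] permutes_image[OF p] r by simp
  moreover have "?S \<noteq> {}" using r by auto
  moreover have "?S \<noteq> {..<k}"
  proof
    assume "?S = {..<k}"
    then have "card (p ` {..<r}) = k" by (simp only: card_lessThan)
    then show False using card_image_le[of "{..<r}" p] r by simp
  qed
  moreover have "M $$ (a, b) = 0" if "a \<in> {..<k} - ?S" "b \<in> ?S" for a b
  proof -
    have "a \<in> p ` {..<k}"
      using that(1) unfolding permutes_image[OF p] by simp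
    then obtain i where i: "i < k" "a = p i" by auto
    then have "r \<le> i" using that(1) by (cases "i < r") simp_all
    then show ?thesis using that(2) z[OF _ i(1)] i(2) by auto
  qed
  ultimately show "\<not> irreducible_on M {..<k}"
    unfolding irreducible_on_def by (intro notI) (drule spec[of _ ?S], simp)
next
  assume "\<not> irreducible_on M {..<k}"
  then obtain S where S: "S \<subseteq> {..<k}" "S \<noteq> {}" "S \<noteq> {..<k}"
    and z: "\<And>i j. i < k \<Longrightarrow> i \<notin> S \<Longrightarrow> j \<in> S \<Longrightarrow> M $$ (i, j) = 0"
    unfolding irreducible_on_def by blast
  define r where "r = card S"
  have fin: "finite S" using S(1) finite_subset by blast
  have r: "0 < r" "r < k"
    using S fin psubset_card_mono[of "{..<k}" S] by (auto simp: r_def card_gt_0_iff)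
  obtain f where f: "bij_betw f {..<r} S"
    using finite_same_card_bij[OF finite_lessThan fin, of r] by (auto simp: r_def)
  have "card {r..<k} = card ({..<k} - S)"
    using S(1) fin by (simp add: card_Diff_subset r_def)
  then obtain g where g: "bij_betw g {r..<k} ({..<k} - S)"
    using finite_same_card_bij[of "{r..<k}" "{..<k} - S"] by auto
  define p where "p i = (if i < r then f i else if i < k then g i else i)" for i
  have pf: "bij_betw p {..<r} S"
    using f by (subst bij_betw_cong[of _ _ f]) (auto simp: p_def)
  have pg: "bij_betw p {r..<k} ({..<k} - S)"
    using g by (subst bij_betw_cong[of _ _ g]) (auto simp: p_def)
  have "bij_betw p ({..<r} \<union> {r..<k}) (S \<union> ({..<k} - S))"
    using pf pg by (rule bij_betw_combine) auto
  moreover have "{..<r} \<union> {r..<k} = {..<k}" "S \<union> ({..<k} - S) = {..<k}"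
    using r S(1) by auto
  ultimately have "p permutes {..<k}"
    using r by (intro bij_imp_permutes) (auto simp: p_def)
  moreover have "M $$ (p i, p j) = 0" if "r \<le> i" "i < k" "j < r" for i j
  proof -
    have "p i \<in> {..<k} - S" "p j \<in> S"
      using bij_betw_apply[OF pg, of i] bij_betw_apply[OF pf, of j] that by simp_all
    then show ?thesis by (intro z) simp_all
  qed
  ultimately show "reducible_mat k M"
    unfolding reducible_mat_def using r by blast
qed

lemma irreducible_principal_submatrix_iff:
  assumes A: "A \<in> carrier_mat n n" and I: "I \<subseteq> {..<n}"
  shows "irreducible_mat (card I) (principal_submatrix A I) \<longleftrightarrow> irreducible_on A I"
proof -
  let ?k = "card I" and ?p = "pick I"
  have bij: "bij_betw ?p {..<?k} I"
    using bij_betw_pick finite_subset[OF I] by blast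
  then have im: "?p ` {..<?k} = I" and inj: "inj_on ?p {..<?k}"
    by (auto simp: bij_betw_def)
  \<comment> \<open>Stating the cut condition for images under \<open>pick\<close> lets the
    quantifier over subsets of the index range pass to subsets of I.\<close>
  define Q where "Q T \<longleftrightarrow> (T \<noteq> {} \<longrightarrow> T \<noteq> I \<longrightarrow> (\<exists>i\<in>I - T. \<exists>j\<in>T. A $$ (i, j) \<noteq> 0))" for T
  have "irreducible_on (principal_submatrix A I) {..<?k} \<longleftrightarrow> (\<forall>S. S \<subseteq> {..<?k} \<longrightarrow> Q (?p ` S))"
    unfolding irreducible_on_def Q_def
  proof (intro all_cong)
    fix S assume S: "S \<subseteq> {..<?k}"
    have diff: "I - ?p ` S = ?p ` ({..<?k} - S)"
      using inj_on_image_set_diff[OF inj _ S] im by auto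
    have eqI: "?p ` S = I \<longleftrightarrow> S = {..<?k}"
      using inj_on_image_eq_iff[OF inj S order_refl] im by auto
    have "(\<exists>i\<in>{..<?k} - S. \<exists>j\<in>S. principal_submatrix A I $$ (i, j) \<noteq> 0) \<longleftrightarrow>
        (\<exists>i\<in>{..<?k} - S. \<exists>j\<in>S. A $$ (?p i, ?p j) \<noteq> 0)"
      using principal_submatrix_index[OF A I] S by (intro bex_cong refl) auto
    then show "(S \<noteq> {} \<longrightarrow> S \<noteq> {..<?k} \<longrightarrow>
        (\<exists>i\<in>{..<?k} - S. \<exists>j\<in>S. principal_submatrix A I $$ (i, j) \<noteq> 0)) \<longleftrightarrow>
      (?p ` S \<noteq> {} \<longrightarrow> ?p ` S \<noteq> I \<longrightarrow> (\<exists>i\<in>I - ?p ` S. \<exists>j\<in>?p ` S. A $$ (i, j) \<noteq> 0))"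
      unfolding diff eqI bex_simps by simp
  qed
  also have "\<dots> \<longleftrightarrow> (\<forall>T. T \<subseteq> ?p ` {..<?k} \<longrightarrow> Q T)"
    by (rule all_subset_image[symmetric])
  also have "\<dots> \<longleftrightarrow> irreducible_on A I"
    unfolding irreducible_on_def Q_def im ..
  finally show ?thesis
    using principal_submatrix_carrier[OF A I]
    by (simp add: irreducible_mat_def reducible_mat_iff_cut)
qed

section \<open>The Gauss-Seidel pencil\<close>

lemma inv_mat:
  assumes M: "M \<in> carrier_mat n n" and det: "det M \<noteq> 0"
  shows "inv_mat M \<in> carrier_mat n n" "M * inv_mat M = 1\<^sub>m n" "inv_mat M * M = 1\<^sub>m n"
proof -
  from det_non_zero_imp_unit[OF M det] mat_inverse(1)[OF M]
  obtain B where B: "mat_inverse M = Some B" by fastforce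
  with mat_inverse(2)[OF M B]
  show "inv_mat M \<in> carrier_mat n n" "M * inv_mat M = 1\<^sub>m n" "inv_mat M * M = 1\<^sub>m n"
    by (auto simp: inv_mat_def)
qed

lemma smult_mat_mult_vec:
  fixes M :: "'a :: comm_ring mat"
  assumes "M \<in> carrier_mat nr nc" "x \<in> carrier_vec nc"
  shows "(c \<cdot>\<^sub>m M) *\<^sub>v x = c \<cdot>\<^sub>v (M *\<^sub>v x)"
  using assms by (intro eq_vecI) (auto simp: scalar_prod_def sum_distrib_left mult.assoc)

lemma mult_mat_zero_vec:
  fixes M :: "'a :: comm_ring mat"
  assumes "M \<in> carrier_mat nr nc"
  shows "M *\<^sub>v 0\<^sub>v nc = 0\<^sub>v nr"
  using assms by (intro eq_vecI) (auto simp: scalar_prod_def)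

text \<open>Kernel vectors are taken as functions with index sums, since they are later restricted
  to index sets and defined by cases.\<close>

lemma det_eq_0_iff_kernel:
  fixes M :: "'a :: field mat"
  assumes M: "M \<in> carrier_mat n n"
  shows "det M = 0 \<longleftrightarrow> (\<exists>x. (\<exists>i<n. x i \<noteq> 0) \<and> (\<forall>i<n. (\<Sum>j<n. M $$ (i, j) * x j) = 0))"
proof
  assume "det M = 0"
  then obtain v where v: "v \<in> carrier_vec n" "v \<noteq> 0\<^sub>v n" "M *\<^sub>v v = 0\<^sub>v n"
    using det_0_iff_vec_prod_zero[OF M] by blast
  have "\<exists>i<n. v $ i \<noteq> 0"
    using v by (metis carrier_vecD eq_vecI index_zero_vec)
  moreover have "(\<Sum>j<n. M $$ (i, j) * v $ j) = 0" if "i < n" for i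
    using arg_cong[OF v(3), of "\<lambda>w. w $ i"] that M v(1)
    by (simp add: scalar_prod_def atLeast0LessThan)
  ultimately show "\<exists>x. (\<exists>i<n. x i \<noteq> 0) \<and> (\<forall>i<n. (\<Sum>j<n. M $$ (i, j) * x j) = 0)"
    by blast
next
  assume "\<exists>x. (\<exists>i<n. x i \<noteq> 0) \<and> (\<forall>i<n. (\<Sum>j<n. M $$ (i, j) * x j) = 0)"
  then obtain x where x: "\<exists>i<n. x i \<noteq> 0" "\<And>i. i < n \<Longrightarrow> (\<Sum>j<n. M $$ (i, j) * x j) = 0"
    by blast
  have "M *\<^sub>v vec n x = 0\<^sub>v n"
    using M x(2) by (intro eq_vecI) (auto simp: scalar_prod_def atLeast0LessThan)
  moreover have "vec n x \<noteq> 0\<^sub>v n"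
    using x(1) by (metis index_vec index_zero_vec(1))
  ultimately show "det M = 0"
    using det_0_iff_vec_prod_zero[OF M] vec_carrier by blast
qed

text \<open>The pencil \<open>\<lambda> (D - L) - U\<close>, whose singular points are the eigenvalues of the iteration matrix.\<close>

definition gs_pencil :: "complex mat \<Rightarrow> complex \<Rightarrow> complex mat" where
  "gs_pencil A z = mat (dim_row A) (dim_row A) (\<lambda>(i, j). if j \<le> i then z * A $$ (i, j) else A $$ (i, j))"

locale gauss_seidel =
  fixes n :: nat and A :: "complex mat"
  assumes A: "A \<in> carrier_mat n n"
    and diag_nz: "\<And>i. i < n \<Longrightarrow> A $$ (i, i) \<noteq> 0"
begin

abbreviation "DL \<equiv> diag_part A - lower_part A"
abbreviation "H \<equiv> fgs_matrix A"

lemma DL_carrier: "DL \<in> carrier_mat n n"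
  using A by (auto simp: lower_part_def diag_part_def)

lemma upper_carrier: "upper_part A \<in> carrier_mat n n"
  using A by (auto simp: upper_part_def)

lemma DL_index: "i < n \<Longrightarrow> j < n \<Longrightarrow> DL $$ (i, j) = (if j \<le> i then A $$ (i, j) else 0)"
  using A by (auto simp: lower_part_def diag_part_def mat_diag_def)

lemma det_DL: "det DL \<noteq> 0"
proof -
  have "det DL = prod_list (diag_mat DL)"
    by (rule det_lower_triangular[OF _ DL_carrier]) (auto simp: DL_index)
  also have "\<dots> = (\<Prod>i\<in>{0..<n}. A $$ (i, i))"
    using DL_carrier by (auto simp: prod_list_diag_prod DL_index simp del: index_minus_mat)
  finally show ?thesis using diag_nz by simp
qed

lemmas inv_DL = inv_mat[OF DL_carrier det_DL]

lemma H_carrier: "H \<in> carrier_mat n n"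
  using inv_DL(1) upper_carrier by (simp add: fgs_matrix_def)

lemma gs_pencil_eq: "gs_pencil A z = z \<cdot>\<^sub>m DL - upper_part A"
  using A by (intro eq_matI) (auto simp: gs_pencil_def upper_part_def lower_part_def diag_part_def mat_diag_def)

lemma gs_pencil_carrier: "gs_pencil A z \<in> carrier_mat n n"
  using A by (auto simp: gs_pencil_def)

text \<open>This is the factorization of the pencil as \<open>DL\<close> times z I -
  \<open>H\<close>. As the pencil at z = 1 is \<open>A\<close>, it also yields the fixed point
  equation of the scheme.\<close>

lemma gs_pencil_mult_vec:
  assumes x: "x \<in> carrier_vec n"
  shows "inv_mat DL *\<^sub>v (gs_pencil A z *\<^sub>v x) = z \<cdot>\<^sub>v x - H *\<^sub>v x"
proof -
  have "gs_pencil A z *\<^sub>v x = z \<cdot>\<^sub>v (DL *\<^sub>v x) - upper_part A *\<^sub>v x"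
    unfolding gs_pencil_eq using x DL_carrier upper_carrier
    by (subst minus_mult_distrib_mat_vec[where nr = n and nc = n])
      (auto simp: smult_mat_mult_vec)
  also have "inv_mat DL *\<^sub>v \<dots> = inv_mat DL *\<^sub>v (z \<cdot>\<^sub>v (DL *\<^sub>v x)) - inv_mat DL *\<^sub>v (upper_part A *\<^sub>v x)"
    using inv_DL(1) DL_carrier upper_carrier x
    by (intro mult_minus_distrib_mat_vec) auto
  also have "inv_mat DL *\<^sub>v (z \<cdot>\<^sub>v (DL *\<^sub>v x)) = z \<cdot>\<^sub>v x"
    using inv_DL DL_carrier x
    by (simp add: mult_mat_vec[where nr = n and nc = n] assoc_mult_mat_vec[symmetric])
  finally show ?thesis
    unfolding fgs_matrix_def using inv_DL(1) upper_carrier x by simp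
qed

lemma eigenvalue_fgs_iff: "eigenvalue H z \<longleftrightarrow> det (gs_pencil A z) = 0"
proof -
  have "gs_pencil A z *\<^sub>v x = 0\<^sub>v n \<longleftrightarrow> H *\<^sub>v x = z \<cdot>\<^sub>v x" if x: "x \<in> carrier_vec n" for x
  proof -
    have Px: "gs_pencil A z *\<^sub>v x \<in> carrier_vec n"
      using gs_pencil_carrier x by (rule mult_mat_vec_carrier)
    have Hx: "H *\<^sub>v x \<in> carrier_vec n"
      using H_carrier x by (rule mult_mat_vec_carrier)
    have recover: "gs_pencil A z *\<^sub>v x = DL *\<^sub>v (inv_mat DL *\<^sub>v (gs_pencil A z *\<^sub>v x))"
      using Px inv_DL DL_carrier by (simp add: assoc_mult_mat_vec[symmetric])
    show ?thesis
    proof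
      assume "gs_pencil A z *\<^sub>v x = 0\<^sub>v n"
      then have *: "z \<cdot>\<^sub>v x - H *\<^sub>v x = 0\<^sub>v n"
        using gs_pencil_mult_vec[OF x, of z] mult_mat_zero_vec[OF inv_DL(1)] by simp
      show "H *\<^sub>v x = z \<cdot>\<^sub>v x"
      proof (rule eq_vecI)
        fix i assume "i < dim_vec (z \<cdot>\<^sub>v x)"
        then show "(H *\<^sub>v x) $ i = (z \<cdot>\<^sub>v x) $ i"
          using arg_cong[OF *, of "\<lambda>w. w $ i"] x Hx carrier_vecD[OF Hx]
          by (simp del: index_mult_mat_vec)
      qed (use x H_carrier in auto)
    next
      assume "H *\<^sub>v x = z \<cdot>\<^sub>v x"
      then have "inv_mat DL *\<^sub>v (gs_pencil A z *\<^sub>v x) = 0\<^sub>v n"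
        using gs_pencil_mult_vec[OF x, of z] x by simp
      then show "gs_pencil A z *\<^sub>v x = 0\<^sub>v n"
        using recover mult_mat_zero_vec[OF DL_carrier] by simp
    qed
  qed
  then show ?thesis
    unfolding det_0_iff_vec_prod_zero[OF gs_pencil_carrier] eigenvalue_def eigenvector_def
    using H_carrier by auto
qed

lemma spectral_radius_fgs_less_1_iff:
  assumes "n > 0"
  shows "spectral_radius H < 1 \<longleftrightarrow> (\<forall>z. cmod z \<ge> 1 \<longrightarrow> det (gs_pencil A z) \<noteq> 0)"
proof -
  note sr = spectral_radius_mem_max[OF H_carrier assms]
  have "spectral_radius H < 1 \<longleftrightarrow> (\<forall>z\<in>spectrum H. cmod z < 1)"
    using sr(1) sr(2) by force
  then show ?thesis
    by (auto simp: spectrum_def eigenvalue_fgs_iff not_le[symmetric])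
qed

lemma fgs_seq_error:
  assumes x: "x \<in> carrier_vec n" and b: "A *\<^sub>v x = b" and d: "d \<in> carrier_vec n"
  shows "fgs_seq A b (x + d) m = x + (H ^\<^sub>m m) *\<^sub>v d"
proof (induction m)
  case 0
  then show ?case using d H_carrier by simp
next
  case (Suc m)
  have Hm: "H ^\<^sub>m m \<in> carrier_mat n n"
    using H_carrier by (rule pow_carrier_mat)
  have A1: "gs_pencil A 1 = A"
    using A by (intro eq_matI) (auto simp: gs_pencil_def)
  have "inv_mat DL *\<^sub>v b = x - H *\<^sub>v x"
    using gs_pencil_mult_vec[OF x, of 1] x by (simp add: A1 b)
  moreover have "H *\<^sub>v (x + (H ^\<^sub>m m) *\<^sub>v d) = H *\<^sub>v x + (H ^\<^sub>m Suc m) *\<^sub>v d"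
  proof -
    \<comment> \<open>Matrix powers append the new factor on the right, whereas the iteration
      multiplies by \<open>H\<close> on the left.\<close>
    have "H * H ^\<^sub>m m = H ^\<^sub>m m * H"
    proof (induction m)
      case 0
      then show ?case using H_carrier by simp
    next
      case (Suc m)
      then show ?case
        using H_carrier pow_carrier_mat[OF H_carrier, of m]
        by (simp add: assoc_mult_mat[symmetric, where ?n\<^sub>1.0 = n and ?n\<^sub>2.0 = n and ?n\<^sub>3.0 = n and ?n\<^sub>4.0 = n])
    qed
    then have "H *\<^sub>v ((H ^\<^sub>m m) *\<^sub>v d) = (H ^\<^sub>m Suc m) *\<^sub>v d"
      using assoc_mult_mat_vec[OF H_carrier Hm d] by simp
    then show ?thesis
      using mult_add_distrib_mat_vec[OF H_carrier x mult_mat_vec_carrier[OF Hm d]] by simp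
  qed
  ultimately show ?case
    unfolding fgs_seq.simps Suc using H_carrier Hm x d pow_carrier_mat[OF H_carrier, of "Suc m"]
    by (intro eq_vecI) (auto simp del: pow_mat.simps index_mult_mat_vec)
qed

text \<open>The error after m steps is H^m applied to the initial error. Starting from the solution
  plus an eigenvector shows z^m tending to 0; conversely, a spectral radius below 1 makes every
  entry of H^m tend to 0.\<close>

lemma fgs_converges_iff:
  assumes n: "n > 0" and b: "b \<in> carrier_vec n"
  shows "fgs_converges n A b \<longleftrightarrow> spectral_radius H < 1"
proof
  assume "fgs_converges n A b"
  then obtain x where x: "x \<in> carrier_vec n" "A *\<^sub>v x = b"
    and lim: "\<And>x0 i. x0 \<in> carrier_vec n \<Longrightarrow> i < n \<Longrightarrow> (\<lambda>m. fgs_seq A b x0 m $ i) \<longlonglongrightarrow> x $ i"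
    unfolding fgs_converges_def by blast
  have "cmod z < 1" if z: "eigenvalue H z" for z
  proof -
    obtain v where ev: "eigenvector H v z"
      using z by (auto simp: eigenvalue_def)
    then have v: "v \<in> carrier_vec n" "v \<noteq> 0\<^sub>v n"
      using H_carrier by (auto simp: eigenvector_def)
    then obtain i where i: "i < n" "v $ i \<noteq> 0"
      by (metis carrier_vecD eq_vecI index_zero_vec)
    have "(\<lambda>m. (x + z ^ m \<cdot>\<^sub>v v) $ i) \<longlonglongrightarrow> x $ i"
      using lim[of "x + v" i] x v i
      by (simp add: fgs_seq_error[OF x v(1)] eigenvector_pow[OF H_carrier ev])
    then have "(\<lambda>m. (x $ i + z ^ m * v $ i - x $ i) / v $ i) \<longlonglongrightarrow> (x $ i - x $ i) / v $ i"
      using x v i by (intro tendsto_intros) auto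
    then have "(\<lambda>m. z ^ m) \<longlonglongrightarrow> 0"
      using i by simp
    then have *: "(\<lambda>m. cmod z ^ m) \<longlonglongrightarrow> 0"
      using tendsto_norm_zero by (fastforce simp: norm_power)
    show ?thesis
    proof (rule ccontr)
      assume "\<not> cmod z < 1"
      then have "1 \<le> cmod z ^ m" for m by simp
      then have "1 \<le> (0::real)"
        using LIMSEQ_le_const[OF *] by blast
      then show False by simp
    qed
  qed
  then show "spectral_radius H < 1"
    using spectral_radius_mem_max(1)[OF H_carrier n] by (auto simp: spectrum_def)
next
  assume sr: "spectral_radius H < 1"
  \<comment> \<open>Singularity of \<open>A\<close> would make 1 an eigenvalue of
    \<open>H\<close>.\<close>
  have "det A \<noteq> 0"
  proof -
    have "gs_pencil A 1 = A"
      using A by (intro eq_matI) (auto simp: gs_pencil_def)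
    then show ?thesis using sr spectral_radius_fgs_less_1_iff[OF n] by (metis norm_one order_refl)
  qed
  note inv = inv_mat[OF A this]
  define x where "x = inv_mat A *\<^sub>v b"
  have x: "x \<in> carrier_vec n" using inv b by (simp add: x_def)
  have Ax: "A *\<^sub>v x = b"
    using inv A b by (simp add: x_def assoc_mult_mat_vec[symmetric])
  have uniq: "y = x" if "y \<in> carrier_vec n" "A *\<^sub>v y = b" for y
    using inv A that by (simp add: x_def assoc_mult_mat_vec[symmetric] flip: that(2))
  define r where "r = (max 0 (spectral_radius H) + 1) / 2"
  have r: "spectral_radius H < r" "0 < r" "r < 1" using sr by (auto simp: r_def)
  obtain c where c: "\<And>m i j. i < n \<Longrightarrow> j < n \<Longrightarrow> cmod ((H ^\<^sub>m m) $$ (i, j)) \<le> c * r ^ m"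
    using power_entries_bound[OF H_carrier r(1,2)] by blast
  have lim: "(\<lambda>m. (H ^\<^sub>m m) $$ (i, j)) \<longlonglongrightarrow> 0" if "i < n" "j < n" for i j
  proof (rule tendsto_0_le[where K = 1])
    show "(\<lambda>m. c * r ^ m) \<longlonglongrightarrow> 0"
      using r LIMSEQ_power_zero[of r] by (auto intro: tendsto_mult_right_zero)
    show "\<forall>\<^sub>F m in sequentially. cmod ((H ^\<^sub>m m) $$ (i, j)) \<le> norm (c * r ^ m) * 1"
      using order_trans[OF c[OF that] abs_ge_self] by simp
  qed
  have "(\<lambda>m. fgs_seq A b x0 m $ i) \<longlonglongrightarrow> x $ i" if x0: "x0 \<in> carrier_vec n" and i: "i < n" for x0 i
  proof -
    define d where "d = x0 - x"
    have d: "d \<in> carrier_vec n" "x0 = x + d"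
      using x x0 by (auto simp: d_def)
    have Hm: "H ^\<^sub>m m \<in> carrier_mat n n" for m
      using H_carrier by (rule pow_carrier_mat)
    have "fgs_seq A b x0 m $ i = x $ i + (\<Sum>j<n. (H ^\<^sub>m m) $$ (i, j) * d $ j)" for m
      using x d i carrier_matD[OF Hm[of m]]
      by (simp add: fgs_seq_error[OF x Ax d(1)] scalar_prod_def atLeast0LessThan)
    moreover have "(\<lambda>m. x $ i + (\<Sum>j<n. (H ^\<^sub>m m) $$ (i, j) * d $ j)) \<longlonglongrightarrow> x $ i + (\<Sum>j<n. 0 * d $ j)"
      by (intro tendsto_intros lim[OF i]) auto
    ultimately show ?thesis by simp
  qed
  then show "fgs_converges n A b"
    unfolding fgs_converges_def using x Ax uniq by blast
qed

end

section \<open>Critical index sets\<close>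

text \<open>Equipotence with weights \<open>\<alpha>\<close> and the ray pattern of the submatrix on \<open>I\<close>; the vector with
  entries \<open>\<alpha>\<^sub>i cis (\<phi> i)\<close> is then in the kernel of the submatrix of the pencil at \<open>z = cis \<psi>\<close>.\<close>

definition gs_critical :: "complex mat \<Rightarrow> nat set \<Rightarrow> (nat \<Rightarrow> real) \<Rightarrow> (nat \<Rightarrow> real) \<Rightarrow> real \<Rightarrow> bool" where
  "gs_critical A I \<alpha> \<phi> \<psi> \<longleftrightarrow>
     (\<forall>i\<in>I. 0 < \<alpha> i) \<and>
     (\<forall>i\<in>I. \<alpha> i * cmod (A $$ (i, i)) = (\<Sum>j\<in>I - {i}. \<alpha> j * cmod (A $$ (i, j)))) \<and>
     (\<forall>i\<in>I. \<forall>j\<in>I. i \<noteq> j \<longrightarrow> A $$ (i, j) / A $$ (i, i) =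
        - complex_of_real (cmod (A $$ (i, j) / A $$ (i, i))) * cis (\<phi> i - \<phi> j + (if i < j then \<psi> else 0)))"

text \<open>After multiplication by the conjugate of the sum s, each real part is at most |s| |w_k|,
  and the totals agree; so each term attains its bound and is a nonnegative real. The conclusion
  avoids division, so it also covers vanishing terms and s = 0.\<close>

lemma triangle_equality_aligned:
  fixes w :: "'b \<Rightarrow> complex"
  assumes fin: "finite F" and eq: "cmod (\<Sum>j\<in>F. w j) = (\<Sum>j\<in>F. cmod (w j))" and j: "j \<in> F"
  shows "of_real (cmod (\<Sum>j\<in>F. w j)) * w j = of_real (cmod (w j)) * (\<Sum>j\<in>F. w j)"
proof -
  define s where "s = (\<Sum>j\<in>F. w j)"
  have le: "Re (cnj s * w k) \<le> cmod s * cmod (w k)" for k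
    using complex_Re_le_cmod[of "cnj s * w k"] by (simp add: norm_mult)
  have "(\<Sum>k\<in>F. Re (cnj s * w k)) = Re (cnj s * s)"
    by (simp only: s_def sum_distrib_left Re_sum)
  also have "\<dots> = cmod s * cmod s"
    using cmod_power2[of s] by (simp add: power2_eq_square)
  also have "\<dots> = (\<Sum>k\<in>F. cmod s * cmod (w k))"
    using eq by (simp add: s_def sum_distrib_left)
  finally have "Re (cnj s * w j) = cmod s * cmod (w j)"
    by (rule sum_mono_inv[OF _ le j fin])
  moreover have "cmod (cnj s * w j) = cmod s * cmod (w j)"
    by (simp add: norm_mult)
  ultimately have cnj: "cnj s * w j = of_real (cmod s * cmod (w j))"
    using cmod_power2[of "cnj s * w j"] by (simp add: complex_eq_iff)
  have "of_real (cmod s) * (of_real (cmod s) * w j) = s * (cnj s * w j)"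
    by (simp add: mult.assoc[symmetric] complex_norm_square[symmetric] power2_eq_square[symmetric])
  also have "\<dots> = of_real (cmod s) * (of_real (cmod (w j)) * s)"
    by (simp add: cnj)
  finally show ?thesis
    by (cases "s = 0") (simp_all add: s_def)
qed

context gauss_seidel
begin

text \<open>Extended by zero, the weights make the row of every outside index with an edge into
  \<open>C\<close> strict: its left side is 0 and its right side positive. The last hypothesis says
  that \<open>C\<close> reaches such a row or a strict row of its own; irreducibility spreads this
  to all of \<open>C\<close>. Strict rows inside \<open>C\<close> serve the forward direction,
  outside indices the converse.\<close>

lemma irreducible_equality:
  assumes Hm: "A \<in> general_H_matrices n"
    and C: "C \<subseteq> {..<n}" "irreducible_on A C"
    and y: "\<And>i. i \<in> C \<Longrightarrow> 0 < y i"
    and ge: "\<And>i. i \<in> C \<Longrightarrow> cmod (A $$ (i, i)) * y i \<le> (\<Sum>j\<in>C - {i}. cmod (A $$ (i, j)) * y j)"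
    and strict: "\<And>X. \<lbrakk>\<And>l. l \<in> C \<Longrightarrow> cmod (A $$ (l, l)) * y l < (\<Sum>j\<in>C - {l}. cmod (A $$ (l, j)) * y j) \<Longrightarrow> l \<in> X;
      \<And>l j. l < n \<Longrightarrow> l \<notin> C \<Longrightarrow> j \<in> C \<Longrightarrow> A $$ (l, j) \<noteq> 0 \<Longrightarrow> l \<in> X;
      \<And>l j. l < n \<Longrightarrow> j \<in> X \<Longrightarrow> l \<noteq> j \<Longrightarrow> A $$ (l, j) \<noteq> 0 \<Longrightarrow> l \<in> X\<rbrakk> \<Longrightarrow> X \<inter> C \<noteq> {}"
  shows "C = {}"
proof (rule ccontr)
  assume "C \<noteq> {}"
  then obtain m where m: "m \<in> C" by blast
  define y' where "y' i = (if i \<in> C then y i else 0)" for i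
  have S: "(\<Sum>j\<in>{..<n} - {i}. cmod (A $$ (i, j)) * y' j) = (\<Sum>j\<in>C - {i}. cmod (A $$ (i, j)) * y j)" for i
    by (rule sum.mono_neutral_cong_right) (use C in \<open>auto simp: y'_def\<close>)
  have S_pos: "0 < (\<Sum>j\<in>C - {l}. cmod (A $$ (l, j)) * y j)"
    if "l \<notin> C" "j \<in> C" "A $$ (l, j) \<noteq> 0" for l j
    using that y finite_subset[OF C(1)]
    by (intro sum_pos2[of _ j]) (auto intro!: mult_nonneg_nonneg less_imp_le[OF y])
  have "y' m = 0"
  proof (rule strict_row_unreachable[OF Hm diag_nz, of y', unfolded S])
    show "m < n" using m C by auto
    show "0 \<le> y' i" for i using y by (simp add: y'_def less_imp_le)
    show "cmod (A $$ (i, i)) * y' i \<le> (\<Sum>j\<in>C - {i}. cmod (A $$ (i, j)) * y j)" for i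
      using ge by (auto simp: y'_def intro!: sum_nonneg mult_nonneg_nonneg less_imp_le[OF y])
    fix X i
    assume st: "\<And>l. l < n \<Longrightarrow> cmod (A $$ (l, l)) * y' l < (\<Sum>j\<in>C - {l}. cmod (A $$ (l, j)) * y j) \<Longrightarrow> l \<in> X"
      and cl: "\<And>l j. l < n \<Longrightarrow> j \<in> X \<Longrightarrow> l \<noteq> j \<Longrightarrow> A $$ (l, j) \<noteq> 0 \<Longrightarrow> l \<in> X"
      and supp: "y' i \<noteq> 0"
    from supp have iC: "i \<in> C" by (auto simp: y'_def split: if_splits)
    have "X \<inter> C \<noteq> {}"
    proof (rule strict)
      fix l
      assume "l \<in> C" "cmod (A $$ (l, l)) * y l < (\<Sum>j\<in>C - {l}. cmod (A $$ (l, j)) * y j)"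
      then show "l \<in> X"
        using st[of l] C(1) by (auto simp: y'_def)
    next
      fix l j
      assume "l < n" "l \<notin> C" "j \<in> C" "A $$ (l, j) \<noteq> 0"
      then show "l \<in> X"
        using st[of l] S_pos[of l j] by (simp add: y'_def)
    next
      fix l j
      assume "l < n" "j \<in> X" "l \<noteq> j" "A $$ (l, j) \<noteq> 0"
      then show "l \<in> X" by (rule cl)
    qed
    moreover have "\<not> (\<exists>i\<in>C - X \<inter> C. \<exists>j\<in>X \<inter> C. A $$ (i, j) \<noteq> 0)"
    proof
      assume "\<exists>i\<in>C - X \<inter> C. \<exists>j\<in>X \<inter> C. A $$ (i, j) \<noteq> 0"
      then obtain l j where "l \<in> C" "l \<notin> X" "j \<in> X" "A $$ (l, j) \<noteq> 0" by blast
      then show False using cl[of l j] C(1) by auto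
    qed
    ultimately have "X \<inter> C = C"
      using C(2)[unfolded irreducible_on_def, rule_format, of "X \<inter> C"] by (meson inf_le2)
    then show "i \<in> X" using iC by blast
  qed
  then show False using y[OF m] m by (simp add: y'_def)
qed

lemma gs_pencil_index:
  "i < n \<Longrightarrow> j < n \<Longrightarrow> gs_pencil A z $$ (i, j) = (if j \<le> i then z * A $$ (i, j) else A $$ (i, j))"
  using A by (simp add: gs_pencil_def)

lemma singular_pencil_imp_critical:
  assumes Hm: "A \<in> general_H_matrices n" and z: "1 \<le> cmod z" and sing: "det (gs_pencil A z) = 0"
  shows "\<exists>C \<alpha> \<phi> \<psi>. C \<subseteq> {..<n} \<and> 2 \<le> card C \<and> irreducible_on A C \<and> gs_critical A C \<alpha> \<phi> \<psi>"
proof -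
  obtain x where x: "\<exists>i<n. x i \<noteq> 0"
      "\<And>i. i < n \<Longrightarrow> (\<Sum>j<n. gs_pencil A z $$ (i, j) * x j) = 0"
    using sing unfolding det_eq_0_iff_kernel[OF gs_pencil_carrier] by blast
  define S where "S = {i. i < n \<and> x i \<noteq> 0}"
  define closed where "closed C \<longleftrightarrow> C \<subseteq> S \<and> C \<noteq> {} \<and> (\<forall>i\<in>C. \<forall>j\<in>S - C. A $$ (i, j) = 0)" for C
  have "closed S" using x(1) by (auto simp: closed_def S_def)
  then obtain C where C: "closed C" and min: "\<And>D. closed D \<Longrightarrow> card C \<le> card D"
    using ex_has_least_nat[of closed S card] by blast
  have CS: "C \<subseteq> S" "C \<noteq> {}" and out: "\<And>i j. i \<in> C \<Longrightarrow> j \<in> S \<Longrightarrow> j \<notin> C \<Longrightarrow> A $$ (i, j) = 0"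
    using C by (auto simp: closed_def)
  then have Cn: "C \<subseteq> {..<n}" and xC: "\<And>i. i \<in> C \<Longrightarrow> x i \<noteq> 0"
    by (auto simp: S_def)
  have fin: "finite C" using Cn finite_subset by blast
  have irr: "irreducible_on A C"
    unfolding irreducible_on_def
  proof (intro allI impI, rule ccontr)
    fix T assume T: "T \<subseteq> C" "T \<noteq> {}" "T \<noteq> C" and no: "\<not> (\<exists>i\<in>C - T. \<exists>j\<in>T. A $$ (i, j) \<noteq> 0)"
    \<comment> \<open>A cut T without incoming edges from the rest of C would leave the smaller
      closed set C - T, against minimality.\<close>
    have "closed (C - T)"
      unfolding closed_def
    proof (intro conjI ballI)
      show "C - T \<subseteq> S" using CS by blast
      show "C - T \<noteq> {}" using T by blast
      fix i j assume ij: "i \<in> C - T" "j \<in> S - (C - T)"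
      show "A $$ (i, j) = 0"
        using ij out[of i j] no by (cases "j \<in> C") auto
    qed
    then have "card C \<le> card (C - T)" by (rule min)
    moreover have "card (C - T) < card C"
      using T fin by (intro psubset_card_mono) auto
    ultimately show False by simp
  qed
  let ?N = "\<lambda>i j. gs_pencil A z $$ (i, j)"
  have Nle: "cmod (?N i j) \<le> cmod z * cmod (A $$ (i, j))" if "i \<in> C" "j \<in> C" for i j
    using that Cn z mult_right_mono[of 1 "cmod z" "cmod (A $$ (i, j))"]
    by (auto simp: gs_pencil_index norm_mult subset_iff)
  \<comment> \<open>Row i of the kernel equation involves only C: elsewhere x vanishes, or the index
    lies in the support and C has no edge to it.\<close>
  have row: "(\<Sum>j\<in>C - {i}. - ?N i j * x j) = z * A $$ (i, i) * x i" if i: "i \<in> C" for i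
  proof -
    have "(\<Sum>j\<in>C. ?N i j * x j) = (\<Sum>j<n. ?N i j * x j)"
    proof (rule sum.mono_neutral_left)
      show "\<forall>j\<in>{..<n} - C. ?N i j * x j = 0"
      proof
        fix j assume j: "j \<in> {..<n} - C"
        then show "?N i j * x j = 0"
          using out[OF i, of j] i Cn by (cases "j \<in> S") (auto simp: S_def gs_pencil_index)
      qed
    qed (use Cn in auto)
    also have "\<dots> = 0" using x(2)[of i] i Cn by auto
    finally have "?N i i * x i + (\<Sum>j\<in>C - {i}. ?N i j * x j) = 0"
      using sum.remove[OF fin i, of "\<lambda>j. ?N i j * x j"] by simp
    moreover have "?N i i = z * A $$ (i, i)"
      using i Cn by (auto simp: gs_pencil_index)
    ultimately show ?thesis by (simp add: sum_negf add_eq_0_iff)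
  qed
  have row_le: "cmod z * (cmod (A $$ (i, i)) * cmod (x i)) \<le> (\<Sum>j\<in>C - {i}. cmod (?N i j) * cmod (x j))"
    if i: "i \<in> C" for i
    using norm_sum[of "\<lambda>j. - ?N i j * x j" "C - {i}"] unfolding row[OF i] by (simp add: norm_mult)
  have N_sum_le: "(\<Sum>j\<in>C - {i}. cmod (?N i j) * cmod (x j)) \<le> cmod z * (\<Sum>j\<in>C - {i}. cmod (A $$ (i, j)) * cmod (x j))"
    if i: "i \<in> C" for i
    unfolding sum_distrib_left mult.assoc[symmetric]
    using Nle[OF i] by (intro sum_mono mult_right_mono) auto
  have ge: "cmod (A $$ (i, i)) * cmod (x i) \<le> (\<Sum>j\<in>C - {i}. cmod (A $$ (i, j)) * cmod (x j))"
    if i: "i \<in> C" for i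
  proof -
    have "0 < cmod z" using z by linarith
    then show ?thesis using order_trans[OF row_le[OF i] N_sum_le[OF i]] by simp
  qed
  have eq: "cmod (A $$ (i, i)) * cmod (x i) = (\<Sum>j\<in>C - {i}. cmod (A $$ (i, j)) * cmod (x j))"
    if i: "i \<in> C" for i
  proof (rule ccontr)
    assume "\<not> ?thesis"
    then have lt: "cmod (A $$ (i, i)) * cmod (x i) < (\<Sum>j\<in>C - {i}. cmod (A $$ (i, j)) * cmod (x j))"
      using ge[OF i] by simp
    have "C = {}"
    proof (rule irreducible_equality[OF Hm Cn irr _ ge])
      show "0 < cmod (x l)" if "l \<in> C" for l using xC[OF that] by simp
      fix X
      assume "\<And>l. l \<in> C \<Longrightarrow> cmod (A $$ (l, l)) * cmod (x l) < (\<Sum>j\<in>C - {l}. cmod (A $$ (l, j)) * cmod (x j)) \<Longrightarrow> l \<in> X"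
      from this[OF i lt] show "X \<inter> C \<noteq> {}" using i by blast
    qed
    then show False using i by simp
  qed
  \<comment> \<open>By equipotence the two ends of the chain \<open>row_le\<close>,
    \<open>N_sum_le\<close> coincide, so the termwise bounds \<open>Nle\<close> are
    equalities.\<close>
  have N_eq: "cmod (?N i j) = cmod z * cmod (A $$ (i, j))" if i: "i \<in> C" and j: "j \<in> C - {i}" for i j
  proof -
    have "(\<Sum>j\<in>C - {i}. cmod (?N i j) * cmod (x j)) = (\<Sum>j\<in>C - {i}. cmod z * cmod (A $$ (i, j)) * cmod (x j))"
      using row_le[OF i] N_sum_le[OF i] by (simp add: eq[OF i] sum_distrib_left mult.assoc)
    then have "cmod (?N i j) * cmod (x j) = cmod z * cmod (A $$ (i, j)) * cmod (x j)"
      by (rule sum_mono_inv) (use Nle[OF i] j fin in \<open>auto intro: mult_right_mono\<close>)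
    then show ?thesis using xC[of j] j by simp
  qed
  have two: "2 \<le> card C"
  proof (rule ccontr)
    assume "\<not> ?thesis"
    moreover have "card C \<noteq> 0" using CS(2) fin by simp
    ultimately have "card C = 1" by simp
    then obtain m where m: "C = {m}" by (auto simp: card_1_singleton_iff)
    then show False using eq[of m] diag_nz[of m] xC[of m] Cn by simp
  qed
  have z1: "cmod z = 1"
  proof (rule ccontr)
    assume "cmod z \<noteq> 1"
    \<comment> \<open>Above the diagonal the pencil lacks the factor z, so equal moduli with |z|
      different from 1 force the entry to be 0. The largest index of C then has no incoming edge
      from C.\<close>
    have up: "A $$ (i, j) = 0" if "i \<in> C" "j \<in> C" "i < j" for i j
      using N_eq[of i j] that \<open>cmod z \<noteq> 1\<close> Cn by (auto simp: gs_pencil_index subset_iff)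
    have Max: "Max C \<in> C" "\<And>i. i \<in> C \<Longrightarrow> i \<le> Max C"
      using fin CS(2) by auto
    have "{Max C} \<noteq> C" using two by (metis card.empty card.insert empty_iff finite.emptyI Suc_1 Suc_n_not_le_n One_nat_def)
    then obtain i where "i \<in> C" "i \<noteq> Max C" "A $$ (i, Max C) \<noteq> 0"
      using irr[unfolded irreducible_on_def, rule_format, of "{Max C}"] Max(1) by auto
    then show False using up[of i "Max C"] Max by (metis le_neq_implies_less)
  qed
  define \<psi> where "\<psi> = Arg z"
  define \<phi> where "\<phi> i = Arg (x i)" for i
  have z_cis: "z = cis \<psi>" using z1 rcis_cmod_Arg[of z] by (simp add: \<psi>_def rcis_def)
  have x_cis: "x i = of_real (cmod (x i)) * cis (\<phi> i)" for i
    using rcis_cmod_Arg[of "x i"] by (simp add: \<phi>_def rcis_def)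
  have "A $$ (i, j) / A $$ (i, i) =
      - of_real (cmod (A $$ (i, j) / A $$ (i, i))) * cis (\<phi> i - \<phi> j + (if i < j then \<psi> else 0))"
    if i: "i \<in> C" and j: "j \<in> C" and ij: "i \<noteq> j" for i j
  proof -
    have Aii: "A $$ (i, i) \<noteq> 0" using diag_nz i Cn by auto
    have "of_real (cmod (z * A $$ (i, i) * x i)) * (- ?N i j * x j) =
        of_real (cmod (- ?N i j * x j)) * (z * A $$ (i, i) * x i)"
    proof (rule triangle_equality_aligned[where F = "C - {i}" and w = "\<lambda>j. - ?N i j * x j", unfolded row[OF i]])
      show "cmod (z * A $$ (i, i) * x i) = (\<Sum>j\<in>C - {i}. cmod (- ?N i j * x j))"
        using eq[OF i] N_eq[OF i] by (simp add: norm_mult z1)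
    qed (use fin j ij in auto)
    then have "of_real (cmod (A $$ (i, i)) * cmod (x i)) * (- ?N i j * (of_real (cmod (x j)) * cis (\<phi> j))) =
        of_real (cmod (A $$ (i, j)) * cmod (x j)) * (z * A $$ (i, i) * (of_real (cmod (x i)) * cis (\<phi> i)))"
      using N_eq[OF i, of j] j ij by (simp add: norm_mult z1 flip: x_cis)
    then have "complex_of_real (cmod (x i) * cmod (x j)) * (of_real (cmod (A $$ (i, i))) * (- ?N i j * cis (\<phi> j))) =
        of_real (cmod (x i) * cmod (x j)) * (of_real (cmod (A $$ (i, j))) * (z * A $$ (i, i) * cis (\<phi> i)))"
      by (simp add: mult_ac)
    then have "of_real (cmod (A $$ (i, i))) * (- ?N i j * cis (\<phi> j)) =
        of_real (cmod (A $$ (i, j))) * (z * A $$ (i, i) * cis (\<phi> i))"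
      using xC[OF i] xC[OF j] by (subst (asm) mult_left_cancel) auto
    then have main: "?N i j = - of_real (cmod (A $$ (i, j)) / cmod (A $$ (i, i))) * (cis \<psi> * A $$ (i, i) * cis (\<phi> i - \<phi> j))"
      using Aii by (simp add: z_cis cis_divide[symmetric] field_simps) (metis minus_minus)
    \<comment> \<open>On and below the diagonal the factor \<open>cis \<psi>\<close> is also present
      in the pencil entry and cancels; above it the factor stays and becomes the shift by
      \<psi>.\<close>
    have quot: "?N i j / A $$ (i, i) = cis \<psi> * (- of_real (cmod (A $$ (i, j) / A $$ (i, i))) * cis (\<phi> i - \<phi> j))"
      unfolding main norm_divide using Aii by simp
    show ?thesis
    proof (cases "i < j")
      case True
      then have "?N i j = A $$ (i, j)" using i j Cn by (auto simp: gs_pencil_index)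
      then show ?thesis
        using quot True by (simp add: cis_mult[symmetric] mult_ac)
    next
      case False
      then have "?N i j = cis \<psi> * A $$ (i, j)" using i j Cn by (auto simp: gs_pencil_index z_cis)
      then have "cis \<psi> * (A $$ (i, j) / A $$ (i, i)) =
          cis \<psi> * (- of_real (cmod (A $$ (i, j) / A $$ (i, i))) * cis (\<phi> i - \<phi> j))"
        using quot by simp
      then show ?thesis
        using False by (subst (asm) mult_left_cancel) auto
    qed
  qed
  then have "gs_critical A C (\<lambda>i. cmod (x i)) \<phi> \<psi>"
    using eq xC by (simp add: gs_critical_def mult.commute)
  then show ?thesis using Cn two irr by blast
qed

text \<open>The pencil evens out the shift by \<psi> across the diagonal, so every off-diagonal term
  points opposite to the diagonal one, whose direction is that of \<open>c\<close>. Equipotence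
  makes the moduli cancel.\<close>

lemma critical_imp_pencil_row:
  assumes I: "I \<subseteq> {..<n}" and crit: "gs_critical A I \<alpha> \<phi> \<psi>" and i: "i \<in> I"
  shows "(\<Sum>j\<in>I. gs_pencil A (cis \<psi>) $$ (i, j) * (of_real (\<alpha> j) * cis (\<phi> j))) = 0"
proof -
  let ?N = "\<lambda>i j. gs_pencil A (cis \<psi>) $$ (i, j)"
  have Aii: "A $$ (i, i) \<noteq> 0" using diag_nz i I by auto
  define c where "c = A $$ (i, i) * cis \<psi> * cis (\<phi> i)"
  have entry: "?N i j * (of_real (\<alpha> j) * cis (\<phi> j)) = - c * of_real (cmod (A $$ (i, j)) / cmod (A $$ (i, i)) * \<alpha> j)"
    if j: "j \<in> I - {i}" for j
  proof -
    have quot: "A $$ (i, j) / A $$ (i, i) =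
        - of_real (cmod (A $$ (i, j) / A $$ (i, i))) * cis (\<phi> i - \<phi> j + (if i < j then \<psi> else 0))"
      using crit i j by (auto simp: gs_critical_def)
    define q where "q = complex_of_real (cmod (A $$ (i, j)) / cmod (A $$ (i, i)))"
    have Aij: "A $$ (i, j) = A $$ (i, i) * (- q * cis (\<phi> i - \<phi> j + (if i < j then \<psi> else 0)))"
      unfolding q_def norm_divide[symmetric] quot[symmetric] using Aii by simp
    have "?N i j = A $$ (i, i) * (- q * (cis (\<phi> i - \<phi> j) * cis \<psi>))"
    proof (cases "i < j")
      case True
      then have "?N i j = A $$ (i, j)" using i j I by (auto simp: gs_pencil_index)
      then show ?thesis using True by (simp add: Aij cis_mult[symmetric])
    next
      case False
      then have "?N i j = cis \<psi> * A $$ (i, j)" using i j I by (auto simp: gs_pencil_index)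
      then show ?thesis using False by (simp add: Aij)
    qed
    then have "?N i j * (of_real (\<alpha> j) * cis (\<phi> j)) = - c * (q * of_real (\<alpha> j))"
      by (simp add: c_def cis_divide[symmetric])
    then show ?thesis by (simp only: q_def of_real_mult)
  qed
  have "(\<Sum>j\<in>I - {i}. ?N i j * (of_real (\<alpha> j) * cis (\<phi> j))) =
      - c * of_real (\<Sum>j\<in>I - {i}. cmod (A $$ (i, j)) / cmod (A $$ (i, i)) * \<alpha> j)"
    by (simp add: entry sum_distrib_left)
  also have "(\<Sum>j\<in>I - {i}. cmod (A $$ (i, j)) / cmod (A $$ (i, i)) * \<alpha> j) =
      (\<Sum>j\<in>I - {i}. \<alpha> j * cmod (A $$ (i, j))) / cmod (A $$ (i, i))"
    by (simp add: sum_divide_distrib mult.commute)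
  also have "\<dots> = \<alpha> i"
    using crit i Aii by (simp add: gs_critical_def divide_eq_eq)
  finally have "(\<Sum>j\<in>I - {i}. ?N i j * (of_real (\<alpha> j) * cis (\<phi> j))) = - c * of_real (\<alpha> i)" .
  moreover have "?N i i * (of_real (\<alpha> i) * cis (\<phi> i)) = c * of_real (\<alpha> i)"
    using i I by (auto simp: gs_pencil_index c_def mult_ac)
  ultimately show ?thesis
    using i finite_subset[OF I] by (simp add: sum.remove[of I i])
qed

lemma critical_imp_singular_pencil:
  assumes Hm: "A \<in> general_H_matrices n"
    and I: "I \<subseteq> {..<n}" "I \<noteq> {}" "irreducible_on A I" and crit: "gs_critical A I \<alpha> \<phi> \<psi>"
  shows "det (gs_pencil A (cis \<psi>)) = 0"
proof -
  let ?N = "\<lambda>i j. gs_pencil A (cis \<psi>) $$ (i, j)"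
  have N0: "?N i j = 0" if "i < n" "j < n" "A $$ (i, j) = 0" for i j
    using that by (simp add: gs_pencil_index)
  define E where "E = {(i, j). i < n \<and> j < n \<and> A $$ (i, j) \<noteq> 0}"
  \<comment> \<open>The outside indices that reach I. Rows outside I and P have no entries in these
    columns, so only rows in P can obstruct an extension of the kernel vector from I by
    zero.\<close>
  define P where "P = {v. v \<notin> I \<and> (\<exists>i\<in>I. (v, i) \<in> E\<^sup>*)}"
  have E_dom: "v < n" if "(v, i) \<in> E\<^sup>*" "i \<in> I" for v i
    using that I(1) by (cases rule: converse_rtranclE) (auto simp: E_def)
  then have Pn: "P \<subseteq> {..<n}" by (auto simp: P_def)
  have into: "v \<in> I \<union> P" if vw: "A $$ (v, w) \<noteq> 0" "v < n" "w \<in> I \<union> P" for v w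
  proof -
    obtain i where i: "i \<in> I" "(w, i) \<in> E\<^sup>*"
      using vw(3) by (auto simp: P_def)
    have "(v, w) \<in> E" using E_dom[OF i(2,1)] vw by (simp add: E_def)
    then have "(v, i) \<in> E\<^sup>*" using i(2) by (rule converse_rtrancl_into_rtrancl)
    then show ?thesis using i(1) by (auto simp: P_def)
  qed
  \<comment> \<open>An edge from i to p would close a path from I through p back into I. The path
    re-enters I from an outside index, whose row is strict for the weights extended by zero.\<close>
  have closed: "A $$ (i, p) = 0" if i: "i \<in> I" and p: "p \<in> P" for i p
  proof (rule ccontr)
    assume Aip: "A $$ (i, p) \<noteq> 0"
    have "I = {}"
    proof (rule irreducible_equality[OF Hm I(1,3), of \<alpha>])
      show "0 < \<alpha> i" if "i \<in> I" for i
        using crit that by (simp add: gs_critical_def)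
      show "cmod (A $$ (i, i)) * \<alpha> i \<le> (\<Sum>j\<in>I - {i}. cmod (A $$ (i, j)) * \<alpha> j)" if "i \<in> I" for i
        using crit that by (simp add: gs_critical_def mult.commute)
      fix X
      assume st: "\<And>l j. l < n \<Longrightarrow> l \<notin> I \<Longrightarrow> j \<in> I \<Longrightarrow> A $$ (l, j) \<noteq> 0 \<Longrightarrow> l \<in> X"
        and cl: "\<And>l j. l < n \<Longrightarrow> j \<in> X \<Longrightarrow> l \<noteq> j \<Longrightarrow> A $$ (l, j) \<noteq> 0 \<Longrightarrow> l \<in> X"
      obtain k where k: "(p, k) \<in> E\<^sup>*" "k \<in> I" using p by (auto simp: P_def)
      have "p \<notin> I \<longrightarrow> p \<in> X"
        using k(1)
      proof (induction rule: converse_rtrancl_induct)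
        case base
        then show ?case using k(2) by simp
      next
        case (step u w)
        then have uw: "u < n" "A $$ (u, w) \<noteq> 0" by (auto simp: E_def)
        show ?case
          using st[OF uw(1) _ _ uw(2)] cl[OF uw(1) _ _ uw(2)] step.IH by blast
      qed
      then have "p \<in> X" using p by (simp add: P_def)
      moreover have "i \<noteq> p" using i p by (auto simp: P_def)
      ultimately have "i \<in> X" using cl[of i p] Aip i I(1) by auto
      then show "X \<inter> I \<noteq> {}" using i by blast
    qed
    then show False using I(2) by simp
  qed
  define x where "x j = (if j \<in> I then of_real (\<alpha> j) * cis (\<phi> j) else 0)" for j
  define w where "w i = (if i \<in> P then \<Sum>j<n. ?N i j * x j else 0)" for i
  have Nx: "(\<Sum>j<n. ?N i j * x j) = w i" if "i < n" for i
  proof -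
    have "(\<Sum>j<n. ?N i j * x j) = (\<Sum>j\<in>I. ?N i j * (of_real (\<alpha> j) * cis (\<phi> j)))"
      by (rule sum.mono_neutral_cong_right) (use I(1) in \<open>auto simp: x_def\<close>)
    also have "\<dots> = 0" if iP: "i \<notin> P"
    proof (cases "i \<in> I")
      case True
      then show ?thesis by (rule critical_imp_pencil_row[OF I(1) crit])
    next
      case False
      have "?N i j = 0" if j: "j \<in> I" for j
        using into[of i j] False iP \<open>i < n\<close> j I(1) by (intro N0) auto
      then show ?thesis by simp
    qed
    finally show ?thesis by (simp add: w_def)
  qed
  \<comment> \<open>The block of the pencil on P, padded by the identity to full size so that P need
    not be renumbered. The identity rows force solutions to vanish off P.\<close>
  define M where "M = mat n n (\<lambda>(i, j). if i \<in> P then if j \<in> P then ?N i j else 0 else if i = j then 1 else 0)"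
  have M: "M \<in> carrier_mat n n" by (simp add: M_def)
  text \<open>The vertices outside \<open>I\<close> that reach \<open>I\<close> span an invariant subspace on which the equation can be
    solved, unless the pencil is already singular there.\<close>
  obtain c v where cv: "c \<noteq> 0 \<or> (\<exists>i<n. v i \<noteq> 0)"
    and Mv: "\<And>i. i < n \<Longrightarrow> (\<Sum>j<n. M $$ (i, j) * v j) = c * w i"
  proof (cases "det M = 0")
    case True
    then show ?thesis
      using that[of 0] unfolding det_eq_0_iff_kernel[OF M] by auto
  next
    case False
    note inv = inv_mat[OF M False]
    define u where "u = inv_mat M *\<^sub>v vec n w"
    have u: "u \<in> carrier_vec n" using inv by (simp add: u_def)
    have Mu: "M *\<^sub>v u = vec n w"
      using assoc_mult_mat_vec[OF M inv(1), of "vec n w"] inv by (simp add: u_def)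
    have "(\<Sum>j<n. M $$ (i, j) * u $ j) = 1 * w i" if "i < n" for i
      using that M u arg_cong[OF Mu, of "\<lambda>v. v $ i"]
      by (simp add: scalar_prod_def atLeast0LessThan)
    then show ?thesis by (intro that[of 1 "\<lambda>j. u $ j"]) simp_all
  qed
  have v0: "v i = 0" if "i < n" "i \<notin> P" for i
  proof -
    have "(\<Sum>j<n. M $$ (i, j) * v j) = (\<Sum>j<n. if j = i then v j else 0)"
      using that by (intro sum.cong) (auto simp: M_def)
    then show ?thesis using Mv[OF that(1)] that by (simp add: w_def)
  qed
  have Nv: "(\<Sum>j<n. ?N i j * v j) = c * w i" if i: "i < n" for i
  proof (cases "i \<in> P")
    case True
    have "(\<Sum>j<n. ?N i j * v j) = (\<Sum>j<n. M $$ (i, j) * v j)"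
      using i True v0 by (intro sum.cong) (auto simp: M_def)
    then show ?thesis using Mv[OF i] by simp
  next
    case False
    have "?N i j * v j = 0" if "j < n" for j
    proof (cases "j \<in> P")
      case True
      then show ?thesis
        using closed[of i j] into[of i j] False i that N0[of i j] by auto
    qed (use v0 that in simp)
    then have "(\<Sum>j<n. ?N i j * v j) = 0" by (intro sum.neutral) auto
    then show ?thesis using False by (simp add: w_def)
  qed
  have "(\<Sum>j<n. ?N i j * (c * x j - v j)) = 0" if "i < n" for i
  proof -
    have "(\<Sum>j<n. ?N i j * (c * x j - v j)) = c * (\<Sum>j<n. ?N i j * x j) - (\<Sum>j<n. ?N i j * v j)"
      by (simp add: sum_distrib_left sum_subtractf right_diff_distrib mult.left_commute)
    then show ?thesis using Nx[OF that] Nv[OF that] by simp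
  qed
  \<comment> \<open>For c = 0 the vector is a nonzero kernel vector on P. Otherwise v vanishes on I
    while x does not, so the two cannot cancel.\<close>
  moreover have "\<exists>i<n. c * x i - v i \<noteq> 0"
  proof (cases "c = 0")
    case True
    then show ?thesis using cv by simp
  next
    case False
    obtain i where i: "i \<in> I" using I(2) by blast
    then have "i < n" "v i = 0" using I(1) v0[of i] by (auto simp: P_def)
    moreover have "x i \<noteq> 0" using i crit by (auto simp: x_def gs_critical_def)
    ultimately show ?thesis using False by auto
  qed
  ultimately show ?thesis
    unfolding det_eq_0_iff_kernel[OF gs_pencil_carrier]
    by (intro exI[of _ "\<lambda>i. c * x i - v i"]) auto
qed

lemma spectral_radius_less_1_iff_no_critical:
  assumes "A \<in> general_H_matrices n" "n > 0"
  shows "spectral_radius H < 1 \<longleftrightarrow>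
    \<not> (\<exists>I \<alpha> \<phi> \<psi>. I \<subseteq> {..<n} \<and> 2 \<le> card I \<and> irreducible_on A I \<and> gs_critical A I \<alpha> \<phi> \<psi>)"
    (is "_ \<longleftrightarrow> \<not> ?R")
proof
  assume sr: "spectral_radius H < 1"
  show "\<not> ?R"
  proof
    assume ?R
    then obtain I \<alpha> \<phi> \<psi> where *: "I \<subseteq> {..<n}" "2 \<le> card I" "irreducible_on A I" "gs_critical A I \<alpha> \<phi> \<psi>"
      by blast
    moreover from *(2) have "I \<noteq> {}" by auto
    ultimately have "det (gs_pencil A (cis \<psi>)) = 0"
      using critical_imp_singular_pencil[OF assms(1)] by blast
    moreover have "1 \<le> cmod (cis \<psi>)" by simp
    ultimately show False
      using sr unfolding spectral_radius_fgs_less_1_iff[OF assms(2)] by blast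
  qed
next
  assume "\<not> ?R"
  then show "spectral_radius H < 1"
    using singular_pencil_imp_critical[OF assms(1)] unfolding spectral_radius_fgs_less_1_iff[OF assms(2)] by blast
qed

end

section \<open>Ray patterns\<close>

abbreviation scaled :: "complex mat \<Rightarrow> complex mat" where
  "scaled M \<equiv> inv_mat (diag_part M) * M"

text \<open>The entries are read off from \<open>D * scaled M = M\<close>, which avoids computing
  the entries of the inverse.\<close>

lemma scaled_index:
  assumes M: "M \<in> carrier_mat k k" and nz: "\<And>r. r < k \<Longrightarrow> M $$ (r, r) \<noteq> 0"
  shows "scaled M \<in> carrier_mat k k"
    and "\<And>r s. r < k \<Longrightarrow> s < k \<Longrightarrow> scaled M $$ (r, s) = M $$ (r, s) / M $$ (r, r)"
proof -
  define D where "D = diag_part M"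
  have D: "D \<in> carrier_mat k k" using M by (simp add: D_def diag_part_def)
  have D_index: "D $$ (r, s) = (if r = s then M $$ (r, r) else 0)" if "r < k" "s < k" for r s
    using that M by (simp add: D_def diag_part_def mat_diag_def)
  have "det D = (\<Prod>r\<in>{0..<k}. M $$ (r, r))"
    using det_lower_triangular[OF _ D] D by (simp add: D_index prod_list_diag_prod)
  then have "det D \<noteq> 0" using nz by simp
  note inv = inv_mat[OF D this]
  show carr: "scaled M \<in> carrier_mat k k"
    using inv(1) M by (simp add: D_def)
  have M_eq: "D * scaled M = M"
    using assoc_mult_mat[OF D inv(1) M] inv(2) M by (simp add: D_def)
  show "scaled M $$ (r, s) = M $$ (r, s) / M $$ (r, r)" if rs: "r < k" "s < k" for r s
  proof -
    have "M $$ (r, s) = (D * scaled M) $$ (r, s)"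
      by (simp only: M_eq)
    also have "\<dots> = (\<Sum>j<k. D $$ (r, j) * scaled M $$ (j, s))"
      using rs carrier_matD[OF D] carrier_matD[OF carr] by (simp add: scalar_prod_def atLeast0LessThan del: index_mult_mat(1) add: index_mult_mat(1)[of r D s "scaled M"])
    also have "\<dots> = (\<Sum>j<k. if j = r then M $$ (r, r) * scaled M $$ (r, s) else 0)"
      using rs by (intro sum.cong) (auto simp: D_index)
    finally show ?thesis using rs nz by simp
  qed
qed

text \<open>Scaling divides each row equation by the modulus of its diagonal entry, so the same
  weights serve both matrices.\<close>

lemma scaled_GDE_iff:
  assumes M: "M \<in> carrier_mat k k" and nz: "\<And>r. r < k \<Longrightarrow> M $$ (r, r) \<noteq> 0"
  shows "scaled M \<in> GDE k \<longleftrightarrow> M \<in> GDE k"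
proof -
  have row: "\<alpha> i * cmod (scaled M $$ (i, i)) = (\<Sum>j\<in>{..<k} - {i}. \<alpha> j * cmod (scaled M $$ (i, j))) \<longleftrightarrow>
      \<alpha> i * cmod (M $$ (i, i)) = (\<Sum>j\<in>{..<k} - {i}. \<alpha> j * cmod (M $$ (i, j)))"
    if i: "i < k" for i and \<alpha> :: "nat \<Rightarrow> real"
  proof -
    have S: "(\<Sum>j\<in>{..<k} - {i}. \<alpha> j * cmod (scaled M $$ (i, j))) =
        (\<Sum>j\<in>{..<k} - {i}. \<alpha> j * cmod (M $$ (i, j))) / cmod (M $$ (i, i))"
      unfolding sum_divide_distrib using i
      by (intro sum.cong) (auto simp: scaled_index(2)[OF M nz] norm_divide)
    have unit: "cmod (scaled M $$ (i, i)) = 1"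
      using nz[OF i] i by (simp add: scaled_index(2)[OF M nz])
    show ?thesis
      unfolding S unit using nz[OF i] by (simp add: eq_divide_eq)
  qed
  show ?thesis
    using scaled_index(1)[OF M nz] M by (simp add: GDE_def row cong: conj_cong)
qed

text \<open>The form of a matrix in \<open>ray_class k \<psi>\<close> with unit diagonal: up to the factor \<open>cis \<psi>\<close>
  above the diagonal, its phases are those of \<open>-u\<^sub>r / u\<^sub>s\<close> with \<open>u\<^sub>r = cis (\<phi> r)\<close>.\<close>

definition ray_form :: "nat \<Rightarrow> complex mat \<Rightarrow> (nat \<Rightarrow> real) \<Rightarrow> real \<Rightarrow> bool" where
  "ray_form k C \<phi> \<psi> \<longleftrightarrow> (\<forall>r<k. \<forall>s<k. r \<noteq> s \<longrightarrow>
     C $$ (r, s) = - complex_of_real (cmod (C $$ (r, s))) * cis (\<phi> r - \<phi> s + (if r < s then \<psi> else 0)))"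

text \<open>The phases are read off column 0 of the pattern. Condition (1) then determines row 0,
  and conditions (2) and (3) with middle index 0 determine the entries below and above the
  diagonal.\<close>

lemma ray_class_iff_ray_form:
  assumes C: "C \<in> carrier_mat k k" and unit: "\<And>r. r < k \<Longrightarrow> C $$ (r, r) = 1" and k: "0 < k"
  shows "C \<in> ray_class k \<psi> \<longleftrightarrow> (\<exists>\<phi>. ray_form k C \<phi> \<psi>)"
proof
  assume "C \<in> ray_class k \<psi>"
  then obtain \<eta> R where R: "psi_ray_pattern k \<psi> R"
    and CR: "\<And>r s. r < k \<Longrightarrow> s < k \<Longrightarrow> C $$ (r, s) = cis \<eta> * of_real (cmod (C $$ (r, s))) * R $$ (r, s)"
    unfolding ray_class_def by blast
  from R obtain a :: "nat \<Rightarrow> nat \<Rightarrow> real" where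
    "\<forall>r<k. \<forall>s<k. R $$ (r, s) = cis (a r s)"
    and "\<forall>r<k. \<forall>s<k. r \<noteq> s \<longrightarrow> [a r s + a s r = \<psi>] (rmod 2 * pi)"
    and "\<forall>r<k. \<forall>s<k. \<forall>t<k. (r < s \<and> s < t) \<or> (s < t \<and> t < r) \<or> (t < r \<and> r < s) \<longrightarrow>
      [a r s - a r t = a t s + pi] (rmod 2 * pi)"
    and "\<forall>r<k. \<forall>s<k. \<forall>t<k. (r < t \<and> t < s) \<or> (t < s \<and> s < r) \<or> (s < r \<and> r < t) \<longrightarrow>
      [a r s - a r t = a t s - \<psi> + pi] (rmod 2 * pi)"
    and "\<forall>r<k. [a r r = 0] (rmod 2 * pi)"
    unfolding psi_ray_pattern_def by (elim conjE exE)
  note Ra = this(1)[rule_format] and a1 = this(2)[rule_format] and a2 = this(3)[rule_format]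
    and a3 = this(4)[rule_format] and a4 = this(5)[rule_format]
  define u where "u r s = cis (a r s)" for r s
  have u_nz: "u r s \<noteq> 0" for r s by (simp add: u_def)
  \<comment> \<open>The entry (0, 0) is 1 and has pattern phase 0, so the common factor
    \<open>cis \<eta>\<close> is 1.\<close>
  have "cis (a 0 0) = 1" using a4[OF k] by (simp add: cis_eq_iff[symmetric])
  then have "cis \<eta> = 1" using CR[OF k k] Ra[OF k k] unit[OF k] by simp
  then have Cu: "C $$ (r, s) = of_real (cmod (C $$ (r, s))) * u r s" if "r < k" "s < k" for r s
    using CR[OF that] Ra[OF that] by (simp add: u_def)
  have u1: "u r s * u s r = cis \<psi>" if "r < k" "s < k" "r \<noteq> s" for r s
    using a1[OF that] by (simp add: u_def cis_mult cis_eq_iff)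
  have u2: "u r s / u r t = - u t s" if "r < k" "s < k" "t < k"
    "(r < s \<and> s < t) \<or> (s < t \<and> t < r) \<or> (t < r \<and> r < s)" for r s t
    using a2[OF that] unfolding cis_eq_iff[symmetric] by (simp add: u_def cis_mult[symmetric] cis_divide[symmetric])
  have u3: "u r s / u r t = - u t s / cis \<psi>" if "r < k" "s < k" "t < k"
    "(r < t \<and> t < s) \<or> (t < s \<and> s < r) \<or> (s < r \<and> r < t)" for r s t
    using a3[OF that] unfolding cis_eq_iff[symmetric] by (simp add: u_def cis_mult[symmetric] cis_divide[symmetric])
  define \<phi> where "\<phi> r = (if r = 0 then 0 else a r 0 + pi)" for r
  have \<phi>: "cis (\<phi> r) = (if r = 0 then 1 else - u r 0)" for r
    by (simp add: \<phi>_def u_def cis_mult[symmetric])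
  have "u r s = - cis (\<phi> r - \<phi> s + (if r < s then \<psi> else 0))" if rs: "r < k" "s < k" "r \<noteq> s" for r s
  proof -
    consider "s = 0" "0 < r" | "r = 0" "0 < s" | "0 < s" "s < r" | "0 < r" "r < s"
      using rs by linarith
    then show ?thesis
    proof cases
      case 1
      then show ?thesis by (simp add: cis_divide[symmetric] \<phi>)
    next
      case 2
      then show ?thesis
        using u1[OF rs] by (simp add: cis_divide[symmetric] cis_mult[symmetric] \<phi> eq_divide_eq u_nz)
    next
      case 3
      then show ?thesis
        using u2[of r 0 s] rs k u_nz by (simp add: cis_divide[symmetric] \<phi> field_simps)
    next
      case 4
      then show ?thesis
        using u3[of r 0 s] rs k u_nz
        by (simp add: cis_divide[symmetric] cis_mult[symmetric] \<phi> field_simps)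
    qed
  qed
  then have "ray_form k C \<phi> \<psi>"
    using Cu unfolding ray_form_def by (metis mult_minus_left mult_minus_right)
  then show "\<exists>\<phi>. ray_form k C \<phi> \<psi>" by blast
next
  assume "\<exists>\<phi>. ray_form k C \<phi> \<psi>"
  then obtain \<phi> where ray: "\<And>r s. r < k \<Longrightarrow> s < k \<Longrightarrow> r \<noteq> s \<Longrightarrow>
     C $$ (r, s) = - of_real (cmod (C $$ (r, s))) * cis (\<phi> r - \<phi> s + (if r < s then \<psi> else 0))"
    unfolding ray_form_def by blast
  \<comment> \<open>The summand \<open>pi\<close> encodes the minus sign of \<open>ray_form\<close>.
    In conditions (2) and (3) it cancels on the left and adds up to \<open>2 * pi\<close> on the
    right, hence the witness 1; in condition (1) the full turn is on the left, hence -1.\<close>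
  define a where "a r s = (if r = s then 0 else pi + \<phi> r - \<phi> s + (if r < s then \<psi> else 0))" for r s
  have "psi_ray_pattern k \<psi> (mat k k (\<lambda>(r, s). cis (a r s)))"
    unfolding psi_ray_pattern_def
  proof (intro conjI exI[of _ a] allI impI)
    fix r s t assume "r < k" "s < k" "t < k"
    show "[a r s - a r t = a t s + pi] (rmod 2 * pi)"
      if "(r < s \<and> s < t) \<or> (s < t \<and> t < r) \<or> (t < r \<and> r < s)"
      unfolding rcong_altdef by (rule exI[of _ 1]) (use that in \<open>auto simp: a_def\<close>)
    show "[a r s - a r t = a t s - \<psi> + pi] (rmod 2 * pi)"
      if "(r < t \<and> t < s) \<or> (t < s \<and> s < r) \<or> (s < r \<and> r < t)"
      unfolding rcong_altdef by (rule exI[of _ 1]) (use that in \<open>auto simp: a_def\<close>)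
  next
    fix r s :: nat assume "r \<noteq> s"
    then show "[a r s + a s r = \<psi>] (rmod 2 * pi)"
      unfolding rcong_altdef by (intro exI[of _ "-1"]) (auto simp: a_def)
  qed (auto simp: a_def)
  moreover have "C $$ (r, s) = cis 0 * of_real (cmod (C $$ (r, s))) * mat k k (\<lambda>(r, s). cis (a r s)) $$ (r, s)"
    if "r < k" "s < k" for r s
  proof (cases "r = s")
    case True
    then show ?thesis using that unit by (simp add: a_def)
  next
    case False
    have "cis (a r s) = - cis (\<phi> r - \<phi> s + (if r < s then \<psi> else 0))"
      using False by (simp add: a_def cis_mult[symmetric] cis_divide[symmetric])
    then show ?thesis using ray[OF that False] that by simp
  qed
  ultimately show "C \<in> ray_class k \<psi>"
    unfolding ray_class_def using C by blast
qed

text \<open>Two off-diagonal entries face two free parameters: the phase at index 1 fits the entry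
  (1, 0), and then \<psi> fits the entry (0, 1). Hence condition (i) speaks of equipotence
  alone.\<close>

lemma ray_form_2: "\<exists>\<phi> \<psi>. ray_form 2 C \<phi> \<psi>"
proof -
  have cis: "z = - of_real (cmod z) * cis (pi + Arg z)" for z
    using rcis_cmod_Arg[of z] by (simp add: rcis_def cis_mult[symmetric])
  define \<phi> where "\<phi> r = (if r = 0 then 0 else pi + Arg (C $$ (1, 0)))" for r :: nat
  have "ray_form 2 C \<phi> (pi + Arg (C $$ (0, 1)) + \<phi> 1)"
    unfolding ray_form_def using cis[of "C $$ (0, 1)"] cis[of "C $$ (1, 0)"]
    by (auto simp: less_2_cases_iff \<phi>_def)
  then show ?thesis by blast
qed

context gauss_seidel
begin

lemma critical_iff_submatrix:
  assumes I: "I \<subseteq> {..<n}"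
  defines "B \<equiv> principal_submatrix A I" and "k \<equiv> card I"
  shows "(\<exists>\<alpha> \<phi> \<psi>. gs_critical A I \<alpha> \<phi> \<psi>) \<longleftrightarrow>
    B \<in> GDE k \<and> (\<exists>\<phi> \<psi>. ray_form k (scaled B) \<phi> \<psi>)"
proof -
  let ?p = "pick I"
  have bij: "bij_betw ?p {..<k} I"
    unfolding k_def using bij_betw_pick finite_subset[OF I] by blast
  have im: "I = ?p ` {..<k}" and inj: "inj_on ?p {..<k}"
    using bij by (auto simp: bij_betw_def)
  have B: "B \<in> carrier_mat k k"
    unfolding B_def k_def by (rule principal_submatrix_carrier[OF A I])
  have B_index: "B $$ (r, s) = A $$ (?p r, ?p s)" if "r < k" "s < k" for r s
    unfolding B_def using principal_submatrix_index[OF A I] that by (simp add: k_def)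
  have pI: "?p r \<in> I" if "r < k" for r using that im by blast
  have B_diag: "B $$ (r, r) \<noteq> 0" if "r < k" for r
    using diag_nz pI[OF that] I by (auto simp: B_index that)
  have sum_eq: "(\<Sum>j\<in>I - {?p r}. f j) = (\<Sum>s\<in>{..<k} - {r}. f (?p s))" if "r < k" for f :: "nat \<Rightarrow> real" and r
  proof -
    have "bij_betw ?p ({..<k} - {r}) (I - {?p r})"
      using bij that pI by (intro bij_betw_DiffI) auto
    then show ?thesis by (rule sum.reindex_bij_betw[symmetric])
  qed
  have less: "?p r < ?p s \<longleftrightarrow> r < s" if "r < k" "s < k" for r s
    using pick_less_iff that by (simp add: k_def)
  have neq: "?p r \<noteq> ?p s \<longleftrightarrow> r \<noteq> s" if "r < k" "s < k" for r s
    using inj that by (auto simp: inj_on_def)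
  have "gs_critical A I \<alpha> \<phi> \<psi> \<longleftrightarrow> (\<forall>r<k. 0 < \<alpha> (?p r)) \<and>
      (\<forall>r<k. \<alpha> (?p r) * cmod (B $$ (r, r)) = (\<Sum>s\<in>{..<k} - {r}. \<alpha> (?p s) * cmod (B $$ (r, s)))) \<and>
      ray_form k (scaled B) (\<phi> \<circ> ?p) \<psi>" for \<alpha> \<phi> \<psi>
  proof -
    have ball: "(\<forall>i\<in>I. Q i) \<longleftrightarrow> (\<forall>r<k. Q (?p r))" for Q
      by (subst im) auto
    have row: "(\<Sum>j\<in>I - {?p r}. \<alpha> j * cmod (A $$ (?p r, j))) = (\<Sum>s\<in>{..<k} - {r}. \<alpha> (?p s) * cmod (B $$ (r, s)))"
      if "r < k" for r
      unfolding sum_eq[OF that] using that by (intro sum.cong) (auto simp: B_index)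
    show ?thesis
      unfolding gs_critical_def ray_form_def ball
      by (simp add: row less neq B_index scaled_index(2)[OF B B_diag] cong: imp_cong)
  qed
  note crit = this
  show ?thesis
  proof
    assume "\<exists>\<alpha> \<phi> \<psi>. gs_critical A I \<alpha> \<phi> \<psi>"
    then obtain \<alpha> \<phi> \<psi> where c: "gs_critical A I \<alpha> \<phi> \<psi>" by blast
    have "B \<in> GDE k"
      unfolding GDE_def using B c[unfolded crit] by (auto intro!: exI[of _ "\<alpha> \<circ> ?p"])
    moreover have "ray_form k (scaled B) (\<phi> \<circ> ?p) \<psi>"
      using c[unfolded crit] by blast
    ultimately show "B \<in> GDE k \<and> (\<exists>\<phi> \<psi>. ray_form k (scaled B) \<phi> \<psi>)" by blast
  next
    assume R: "B \<in> GDE k \<and> (\<exists>\<phi> \<psi>. ray_form k (scaled B) \<phi> \<psi>)"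
    then obtain \<alpha> where \<alpha>: "\<forall>r<k. 0 < \<alpha> r"
      "\<forall>r<k. \<alpha> r * cmod (B $$ (r, r)) = (\<Sum>s\<in>{..<k} - {r}. \<alpha> s * cmod (B $$ (r, s)))"
      unfolding GDE_def by blast
    from R obtain \<phi> \<psi> where ray: "ray_form k (scaled B) \<phi> \<psi>" by blast
    \<comment> \<open>Weights and phases indexed by positions in the submatrix are carried back to
      the indices in I.\<close>
    define q where "q = inv_into {..<k} ?p"
    have q: "q (?p r) = r" if "r < k" for r
      using inj that by (simp add: q_def)
    have "gs_critical A I (\<alpha> \<circ> q) (\<phi> \<circ> q) \<psi>"
      unfolding crit using \<alpha> ray by (simp add: q ray_form_def)
    then show "\<exists>\<alpha> \<phi> \<psi>. gs_critical A I \<alpha> \<phi> \<psi>" by blast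
  qed
qed

end

theorem theorem4p24:
  fixes n :: nat and A :: "complex mat"
  assumes "n \<ge> 1"
    and "A \<in> general_H_matrices n"
    and "\<forall>i<n. A $$ (i, i) \<noteq> 0"
  shows "(spectral_radius (fgs_matrix A) < 1 \<longleftrightarrow>
      \<not> (\<exists>I. I \<subseteq> {..<n} \<and> card I = 2 \<and>
            irreducible_mat 2 (principal_submatrix A I) \<and>
            principal_submatrix A I \<in> GDE 2) \<and>
      \<not> (\<exists>k I. 3 \<le> k \<and> k \<le> n \<and> I \<subseteq> {..<n} \<and> card I = k \<and>
            irreducible_mat k (principal_submatrix A I) \<and>
            (\<exists>\<psi>. inv_mat (diag_part (principal_submatrix A I)) * principal_submatrix A I
                  \<in> ray_class k \<psi> \<inter> GDE k))) \<and>
    (\<forall>b\<in>carrier_vec n. spectral_radius (fgs_matrix A) < 1 \<longleftrightarrow> fgs_converges n A b)"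
    (is "(?sr \<longleftrightarrow> \<not> ?two \<and> \<not> ?more) \<and> ?conv")
proof -
  have A: "A \<in> carrier_mat n n"
    using assms(2) by (simp add: general_H_matrices_def)
  interpret gauss_seidel n A
    using A assms(3) by unfold_locales auto
  have n: "n > 0" using assms(1) by simp
  let ?B = "principal_submatrix A" and ?C = "\<lambda>I. scaled (principal_submatrix A I)"
  have ray: "(\<exists>\<psi>. ?C I \<in> ray_class k \<psi> \<inter> GDE k) \<longleftrightarrow> ?B I \<in> GDE k \<and> (\<exists>\<phi> \<psi>. ray_form k (?C I) \<phi> \<psi>)"
    if I: "I \<subseteq> {..<n}" and k: "card I = k" "0 < k" for I k
  proof -
    have B: "?B I \<in> carrier_mat k k"
      using principal_submatrix_carrier[OF A I] k by simp
    have pick: "pick I r < n" if "r < k" for r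
      using pick_in_set_le[of r I] that k I by auto
    have nz: "?B I $$ (r, r) \<noteq> 0" if "r < k" for r
      using principal_submatrix_index[OF A I] diag_nz[OF pick[OF that]] that k by simp
    have "?C I \<in> ray_class k \<psi> \<longleftrightarrow> (\<exists>\<phi>. ray_form k (?C I) \<phi> \<psi>)" for \<psi>
      using scaled_index[OF B nz] nz k by (intro ray_class_iff_ray_form) auto
    then show ?thesis using scaled_GDE_iff[OF B nz] by auto
  qed
  \<comment> \<open>By \<open>ray_form_2\<close> the phase condition in \<open>gs_critical\<close>
    is automatic for two indices.\<close>
  have two: "?two \<longleftrightarrow> (\<exists>I \<alpha> \<phi> \<psi>. I \<subseteq> {..<n} \<and> card I = 2 \<and> irreducible_on A I \<and> gs_critical A I \<alpha> \<phi> \<psi>)"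
    using critical_iff_submatrix ray_form_2 irreducible_principal_submatrix_iff[OF A] by metis
  have more: "?more \<longleftrightarrow> (\<exists>I \<alpha> \<phi> \<psi>. I \<subseteq> {..<n} \<and> 3 \<le> card I \<and> irreducible_on A I \<and> gs_critical A I \<alpha> \<phi> \<psi>)"
    (is "_ \<longleftrightarrow> ?more'")
  proof
    assume ?more
    then obtain k I where *: "3 \<le> k" "I \<subseteq> {..<n}" "card I = k" "irreducible_mat k (?B I)"
        "\<exists>\<psi>. ?C I \<in> ray_class k \<psi> \<inter> GDE k"
      by blast
    then have "\<exists>\<alpha> \<phi> \<psi>. gs_critical A I \<alpha> \<phi> \<psi>"
      using critical_iff_submatrix[OF *(2)] ray[OF *(2,3)] by simp
    moreover have "irreducible_on A I"
      using irreducible_principal_submatrix_iff[OF A *(2)] * by simp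
    ultimately show ?more' using * by blast
  next
    assume ?more'
    then obtain I where *: "I \<subseteq> {..<n}" "3 \<le> card I" "irreducible_on A I" "\<exists>\<alpha> \<phi> \<psi>. gs_critical A I \<alpha> \<phi> \<psi>"
      by blast
    then have "\<exists>\<psi>. ?C I \<in> ray_class (card I) \<psi> \<inter> GDE (card I)"
      using critical_iff_submatrix[OF *(1)] ray[OF *(1) refl] by auto
    moreover have "card I \<le> n" using card_mono[OF _ *(1)] by simp
    moreover have "irreducible_mat (card I) (?B I)"
      using irreducible_principal_submatrix_iff[OF A *(1)] * by simp
    ultimately show ?more using * by blast
  qed
  have "2 \<le> card I \<longleftrightarrow> card I = 2 \<or> 3 \<le> card I" for I :: "nat set" by auto
  then have "?sr \<longleftrightarrow> \<not> ?two \<and> \<not> ?more"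
    unfolding spectral_radius_less_1_iff_no_critical[OF assms(2) n] two more by auto
  then show ?thesis using fgs_converges_iff[OF n] by blast
qed

end
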